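(* Let $\tau\in\mathbb{Z}$ and let $U^\tau$ be the unknot with framing $\tau$. (1) The dual $A$-polynomial of $U^\tau$ is (up to multiplication by a nonzero constant and a monomial in $x,y,a^{1/2}$) $$\mathcal{A}_{U^\tau}(x,y,a)=(-1)^\tau(y^2-1)-x\left(a^{\frac12}y^2-a^{-\frac12}\right)y^{2\tau}.$$ (2) For all integers $r\ge 1$ and $m$, the BPS invariant $b_{r,m}(U^\tau)$ is given by $$b_{r,m}(U^\tau)=\frac{1}{r^2}\sum_{d\mid r,\ d\mid m}\mu(d)\,c_{\frac rd,\frac md}(U^\tau),$$ where $\mu$ is the Möbius function and $$c_{r,m}(U^\tau)=(-1)^{r\tau+r+\frac{r+m}{2}}\binom{r}{\frac{r+m}{2}}\binom{r\tau+\frac{r+m}{2}-1}{r-1}$$ if $r+m$ is even and $|m|\le r$, and $c_{r,m}(U^\tau)=0$ otherwise.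
   Context: Binomial coefficients: for $n<0$ and $k\ge0$, $\binom nk=(-1)^k\binom{-n+k-1}{k}$. Colored HOMFLYPT invariants of the unknot (symmetric representations): $H_0(U;q,a)=1$ and $$H_n(U;q,a)=\prod_{k=1}^{n}\frac{a^{\frac12}q^{\frac{k-1}{2}}-a^{-\frac12}q^{-\frac{k-1}{2}}}{q^{\frac k2}-q^{-\frac k2}}\qquad(n\ge1).$$ The framed invariants are $\mathcal{H}_n(U^\tau;q,a)=(-1)^{n\tau}q^{\frac{n(n-1)}{2}\tau}H_n(U;q,a)$. Dual $A$-polynomial: let $M,L$ act on sequences $(f_n)_{n\ge0}$ by $Mf_n=q^{n/2}f_n$, $Lf_n=f_{n+1}$, so $LM=q^{1/2}ML$. Let $\hat A(M,L,a,q)=\sum_{l=0}^{d}a_l(M,a,q)L^l$ be a nonzero operator of minimal order $d$ in $L$ annihilating $(\mathcal{H}_n(U^\tau;q,a))_n$ for all but finitely many $n$, with coefficients $a_l$ Laurent polynomials in $M,a^{1/2},q^{1/2}$ (over $\mathbb{Q}$) having no common non-unit factor. Put $A_{U^\tau}(M,L,a)=\hat A(M,L,a,1)$ (i.e. $q^{1/2}=1$). The dual $A$-polynomial is $\mathcal{A}_{U^\tau}(x,y,a)=A_{U^\tau}(y,x^{-1},a)$, considered up to multiplication by a nonzero constant and a monomial in $x,y,a^{1/2}$. BPS invariants: define $\mathfrak{f}_r(U^\tau;a,q)$, $r\ge1$, by $$\sum_{r\ge0}\mathcal{H}_r(U^\tau;q,a)x^r=\exp\left(\sum_{d\ge1}\sum_{r\ge1}\frac1d\,\mathfrak{f}_r(U^\tau;a^d,q^d)x^{rd}\right).$$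 Standing assumption (Ooguri–Vafa form): $\mathfrak{f}_r$ is a finite sum $\mathfrak{f}_r(U^\tau;a,q)=\sum_{i,j\in\mathbb{Z}}\frac{N_{r,i,j}(U^\tau)a^{i/2}q^{j/2}}{q^{1/2}-q^{-1/2}}$ with $N_{r,i,j}(U^\tau)\in\mathbb{Z}$. Then $b_{r,i}(U^\tau)=\sum_jN_{r,i,j}(U^\tau)$. *)

theory Defs
  imports
    "HOL-Computational_Algebra.Computational_Algebra"
    "HOL-Library.Poly_Mapping"
    "HOL-Library.Product_Plus"
begin

text \<open>
  Laurent polynomials over the rationals are finitely supported functions from exponent vectors
  to coefficients, with the convolution product of \<^theory>\<open>HOL-Library.Poly_Mapping\<close>; the
  exponents are added componentwise. The variables are told apart by position only:
  \<^item> coefficients of operators: \<open>(M, a\<^sup>1\<^sup>/\<^sup>2, q\<^sup>1\<^sup>/\<^sup>2)\<close>;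
  \<^item> coefficients of operators after \<open>q\<^sup>1\<^sup>/\<^sup>2 = 1\<close>: \<open>(M, a\<^sup>1\<^sup>/\<^sup>2)\<close>;
  \<^item> dual A-polynomials: \<open>(x, y, a\<^sup>1\<^sup>/\<^sup>2)\<close>.
\<close>

type_synonym laurent2 = "(int \<times> int) \<Rightarrow>\<^sub>0 rat"
type_synonym laurent3 = "(int \<times> int \<times> int) \<Rightarrow>\<^sub>0 rat"

definition laurent3_eval :: "laurent3 \<Rightarrow> 'a::field_char_0 \<Rightarrow> 'a \<Rightarrow> 'a \<Rightarrow> 'a" where
  "laurent3_eval p u v w =
     (\<Sum>(i, j, k)\<in>Poly_Mapping.keys p.
        of_rat (Poly_Mapping.lookup p (i, j, k)) * u powi i * v powi j * w powi k)"

text \<open>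
  The invariants live in the field of rational functions over the rationals in \<open>a\<^sup>1\<^sup>/\<^sup>2\<close> (the outer
  polynomial variable) and \<open>q\<^sup>1\<^sup>/\<^sup>2\<close> (the inner one), obtained as the fraction field of the ring of
  polynomials with integer coefficients.
\<close>

type_synonym ratfun = "int poly poly fract"

definition ah :: ratfun where "ah = Fract [:0, 1:] 1"
definition qh :: ratfun where "qh = Fract [:[:0, 1:]:] 1"

text \<open>
  The substitution \<open>F(a, q) \<mapsto> F(a\<^sup>d, q\<^sup>d)\<close>, meant for \<open>d \<ge> 1\<close>; it acts on the square roots by
  \<open>a\<^sup>1\<^sup>/\<^sup>2 \<mapsto> a\<^sup>d\<^sup>/\<^sup>2\<close> and \<open>q\<^sup>1\<^sup>/\<^sup>2 \<mapsto> q\<^sup>d\<^sup>/\<^sup>2\<close>.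
\<close>

definition poly_subst_powers :: "nat \<Rightarrow> int poly poly \<Rightarrow> ratfun" where
  "poly_subst_powers d p =
     poly (map_poly (\<lambda>c. poly (map_poly of_int c) (qh ^ d)) p) (ah ^ d)"

definition subst_powers :: "nat \<Rightarrow> ratfun \<Rightarrow> ratfun" where
  "subst_powers d F =
     poly_subst_powers d (fst (quot_of_fract F)) / poly_subst_powers d (snd (quot_of_fract F))"

definition homfly_unknot :: "nat \<Rightarrow> ratfun" where
  "homfly_unknot n =
     (\<Prod>k=1..n. (ah * qh ^ (k - 1) - inverse ah * inverse (qh ^ (k - 1)))
               / (qh ^ k - inverse (qh ^ k)))"

text \<open>The exponent of \<open>q\<^sup>1\<^sup>/\<^sup>2\<close> in the framing factor is \<open>2 \<cdot> (n(n - 1)/2) \<cdot> \<tau>\<close>.\<close>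

definition framed_homfly_unknot :: "int \<Rightarrow> nat \<Rightarrow> ratfun" where
  "framed_homfly_unknot \<tau> n =
     (- 1) powi (int n * \<tau>) * qh powi (int n * (int n - 1) * \<tau>) * homfly_unknot n"

text \<open>
  An operator \<open>\<Sum>\<^sub>l a\<^sub>l(M, a, q) L\<^sup>l\<close> is stored as the polynomial in \<open>L\<close> with coefficients \<open>a\<^sub>l\<close>, so that
  \<^const>\<open>degree\<close> is its order. The commutative product of \<^typ>\<open>laurent3 poly\<close> is not the
  composition of operators and is never used.

  Since \<open>(Mf)\<^sub>n = q\<^sup>n\<^sup>/\<^sup>2 f\<^sub>n\<close> and \<open>(Lf)\<^sub>n = f\<^sub>n\<^sub>+\<^sub>1\<close>, the operator sends \<open>f\<close> to the sequence
  \<open>n \<mapsto> \<Sum>\<^sub>l a\<^sub>l(q\<^sup>n\<^sup>/\<^sup>2, a, q) f\<^sub>n\<^sub>+\<^sub>l\<close>.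
\<close>

definition op_apply :: "laurent3 poly \<Rightarrow> (nat \<Rightarrow> ratfun) \<Rightarrow> nat \<Rightarrow> ratfun" where
  "op_apply A f n = (\<Sum>l\<le>degree A. laurent3_eval (coeff A l) (qh ^ n) ah qh * f (n + l))"

definition annihilates :: "laurent3 poly \<Rightarrow> (nat \<Rightarrow> ratfun) \<Rightarrow> bool" where
  "annihilates A f \<longleftrightarrow> finite {n. op_apply A f n \<noteq> 0}"

definition is_minimal_recursion :: "(nat \<Rightarrow> ratfun) \<Rightarrow> laurent3 poly \<Rightarrow> bool" where
  "is_minimal_recursion f A \<longleftrightarrow>
     A \<noteq> 0 \<and> annihilates A f \<and>
     (\<forall>B. B \<noteq> 0 \<longrightarrow> annihilates B f \<longrightarrow> degree A \<le> degree B) \<and>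
     (\<forall>g. (\<forall>l. g dvd coeff A l) \<longrightarrow> g dvd 1)"

definition laurent_at_q1 :: "laurent3 \<Rightarrow> laurent2" where
  "laurent_at_q1 p =
     (\<Sum>(i, j, k)\<in>Poly_Mapping.keys p.
        Poly_Mapping.single (i, j) (Poly_Mapping.lookup p (i, j, k)))"

definition classical_limit :: "laurent3 poly \<Rightarrow> laurent2 poly" where
  "classical_limit A = map_poly laurent_at_q1 A"

text \<open>The substitution \<open>A(M, L, a) \<mapsto> A(y, x\<^sup>-\<^sup>1, a)\<close>.\<close>

definition dual_substitution :: "laurent2 poly \<Rightarrow> laurent3" where
  "dual_substitution A =
     (\<Sum>l\<le>degree A. \<Sum>(i, j)\<in>Poly_Mapping.keys (coeff A l).
        Poly_Mapping.single (- int l, i, j) (Poly_Mapping.lookup (coeff A l) (i, j)))"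

definition is_dual_A_polynomial :: "(nat \<Rightarrow> ratfun) \<Rightarrow> laurent3 \<Rightarrow> bool" where
  "is_dual_A_polynomial f P \<longleftrightarrow>
     (\<exists>A. is_minimal_recursion f A \<and> P = dual_substitution (classical_limit A))"

definition eq_up_to_monomial :: "laurent3 \<Rightarrow> laurent3 \<Rightarrow> bool" where
  "eq_up_to_monomial P Q \<longleftrightarrow> (\<exists>c e. c \<noteq> 0 \<and> P = Poly_Mapping.single e c * Q)"

definition mon :: "int \<Rightarrow> int \<Rightarrow> int \<Rightarrow> laurent3" where
  "mon i j k = Poly_Mapping.single (i, j, k) 1"

definition unknot_dual_A :: "int \<Rightarrow> laurent3" where
  "unknot_dual_A \<tau> =
     Poly_Mapping.single 0 ((- 1) powi \<tau>) * (mon 0 2 0 - 1)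
     - mon 1 0 0 * (mon 0 2 1 - mon 0 0 (- 1)) * mon 0 (2 * \<tau>) 0"

text \<open>
  The coefficient of \<open>x\<^sup>n\<close> in \<open>\<Sum>\<^sub>d\<^sub>,\<^sub>r (1/d) f\<^sub>r(a\<^sup>d, q\<^sup>d) x\<^sup>r\<^sup>d\<close> is the sum over the finitely many pairs
  with \<open>r d = n\<close>; there are none for \<open>n = 0\<close>, so that the composition below is the exponential of
  a series with zero constant term. The value \<open>f 0\<close> does not matter.
\<close>

definition plethystic_sum :: "(nat \<Rightarrow> ratfun) \<Rightarrow> ratfun fps" where
  "plethystic_sum f =
     Abs_fps (\<lambda>n. \<Sum>(d, r)\<in>{(d, r). 1 \<le> d \<and> 1 \<le> r \<and> r * d = n}.
                    inverse (of_nat d) * subst_powers d (f r))"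

definition BPS_functions :: "(nat \<Rightarrow> ratfun) \<Rightarrow> (nat \<Rightarrow> ratfun) \<Rightarrow> bool" where
  "BPS_functions H f \<longleftrightarrow> Abs_fps H = fps_compose (fps_exp 1) (plethystic_sum f)"

definition ooguri_vafa_form ::
    "(nat \<Rightarrow> ratfun) \<Rightarrow> (nat \<Rightarrow> int \<Rightarrow> int \<Rightarrow> int) \<Rightarrow> bool" where
  "ooguri_vafa_form f N \<longleftrightarrow>
     (\<forall>r\<ge>1. finite {(i, j). N r i j \<noteq> 0} \<and>
        f r = (\<Sum>(i, j)\<in>{(i, j). N r i j \<noteq> 0}.
                 of_int (N r i j) * ah powi i * qh powi j / (qh - inverse qh)))"

definition BPS_b :: "(nat \<Rightarrow> int \<Rightarrow> int \<Rightarrow> int) \<Rightarrow> nat \<Rightarrow> int \<Rightarrow> int" where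
  "BPS_b N r i = (\<Sum>j\<in>{j. N r i j \<noteq> 0}. N r i j)"

definition moebius :: "nat \<Rightarrow> int" where
  "moebius n = (if squarefree n then (- 1) ^ card (prime_factors n) else 0)"

text \<open>
  For a negative integer upper argument, \<^const>\<open>gbinomial\<close> satisfies
  \<open>(n gchoose k) = (-1)\<^sup>k ((-n + k - 1) choose k)\<close>.
\<close>

definition BPS_c :: "int \<Rightarrow> nat \<Rightarrow> int \<Rightarrow> rat" where
  "BPS_c \<tau> r m =
     (if even (int r + m) \<and> \<bar>m\<bar> \<le> int r
      then (- 1) powi (int r * \<tau> + int r + (int r + m) div 2)
           * of_nat (r choose nat ((int r + m) div 2))
           * (of_int (int r * \<tau> + (int r + m) div 2 - 1) gchoose (r - 1))
      else 0)"

end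

theory Submission
  imports Defs "HOL-Library.Product_Lexorder"
begin

text \<open>
  Write \<open>s = q\<^sup>1\<^sup>/\<^sup>2\<close>, \<open>\<alpha> = a\<^sup>1\<^sup>/\<^sup>2\<close> and \<open>H\<^sub>n\<close> for the framed invariants. Everything rests on the fact that
  the quotients of consecutive invariants are explicit:
  \<open>(s\<^bsup>n+1\<^esup> - s\<^bsup>-n-1\<^esup>) H\<^sub>n\<^sub>+\<^sub>1 = (-1)\<^sup>\<tau> s\<^bsup>2n\<tau>\<^esup> (\<alpha> s\<^sup>n - \<alpha>\<^sup>-\<^sup>1 s\<^sup>-\<^sup>n) H\<^sub>n\<close>.

  The A-polynomial. With \<open>M = s\<^sup>n\<close> the relation is an operator of order one. A Laurent polynomial that
  vanishes at \<open>(s\<^sup>n, \<alpha>, s)\<close> for infinitely many \<open>n\<close> is zero, because for large \<open>n\<close> distinct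
  monomials stay distinct (\<open>laurent3_eq_0_if_eval_eq_0\<close>). Hence no operator of order zero annihilates
  the sequence, and every annihilating operator of order one is proportional to the explicit one.
  Its two coefficients are coprime: this is \<open>unknot_lead_dvd_cancel\<close>, which replaces unique
  factorisation by a truncation in the degree of \<open>\<alpha>\<close>. So a minimal operator
  without common factors is a unit times the explicit one, and the units are the monomials
  (\<open>laurent_unit_is_monomial\<close>). Setting \<open>s = 1\<close> gives the dual A-polynomial.

  The BPS invariants. Let \<open>F(x) = \<Sum>\<^sub>n H\<^sub>n x\<^sup>n = exp P(x)\<close>. The relation says
  \<open>F(s x) - F(s\<^sup>-\<^sup>1 x) = (-1)\<^sup>\<tau> x (\<alpha> F(s\<^bsup>2\<tau>+1\<^esup> x) - \<alpha>\<^sup>-\<^sup>1 F(s\<^bsup>2\<tau>-1\<^esup> x))\<close>. In the Ooguri-Vafa form the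
  coefficients of \<open>P\<close> have at most a simple pole at \<open>s = 1\<close>; let \<open>G\<^sub>n\<close> be the value of \<open>(s - s\<^sup>-\<^sup>1) P\<^sub>n\<close>
  there. Dividing the functional equation by \<open>F(x)\<close> and letting \<open>s\<close> tend to 1 turns
  \<open>F(s\<^sup>k x) / F(x) = exp (P(s\<^sup>k x) - P(x))\<close> into \<open>exp (k/2 \<Sum>\<^sub>n n G\<^sub>n x\<^sup>n)\<close>, so that \<open>Y = exp (\<Sum>\<^sub>n n G\<^sub>n x\<^sup>n)\<close>
  satisfies \<open>Y - 1 = (-1)\<^sup>\<tau> x (\<alpha> Y\<^bsup>\<tau>+1\<^esup> - \<alpha>\<^sup>-\<^sup>1 Y\<^sup>\<tau>)\<close> (\<open>classical_limit_equation\<close>), which is the vanishing of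
  the dual A-polynomial at \<open>Y = y\<^sup>2\<close>. Lagrange inversion (\<open>lagrange_two_exponentials\<close>) expands
  \<open>log Y\<close> and gives \<open>n\<^sup>2 G\<^sub>n = \<Sum>\<^sub>m c\<^sub>n\<^sub>,\<^sub>m \<alpha>\<^sup>m\<close>. On the other hand the multiple covers in \<open>P\<close> contribute
  \<open>n\<^sup>2 G\<^sub>n = \<Sum>\<^sub>m \<Sum>\<^sub>d (n/d)\<^sup>2 b\<^bsub>n/d,m/d\<^esub> \<alpha>\<^sup>m\<close>, with \<open>d\<close> running over the common divisors of \<open>n\<close> and \<open>m\<close>.
  Comparing coefficients and Moebius inversion (\<open>moebius_inversion_pairs\<close>) isolate \<open>b\<^bsub>r,m\<^esub>\<close>.
\<close>

section \<open>Specialising rational functions\<close>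

lemma map_poly_plus_hom:
  assumes "h 0 = 0" "\<And>x y. h (x + y) = h x + h y"
  shows "map_poly h (p + q) = map_poly h p + map_poly h q"
  by (rule poly_eqI) (simp add: coeff_map_poly assms)

lemma map_poly_times_hom:
  assumes h0: "h 0 = 0" and hp: "\<And>x y. h (x + y) = h x + h y" and hm: "\<And>x y. h (x * y) = h x * h y"
  shows "map_poly h (p * q) = map_poly h p * map_poly h q"
proof (rule poly_eqI)
  fix n
  have hs: "h (sum g A) = (\<Sum>x\<in>A. h (g x))" for g and A :: "nat set"
    by (induction A rule: infinite_finite_induct) (simp_all add: h0 hp)
  show "coeff (map_poly h (p * q)) n = coeff (map_poly h p * map_poly h q) n"
    by (simp add: coeff_map_poly h0 coeff_mult hs hm)
qed

text \<open>
  The value of a polynomial at \<open>a\<^sup>1\<^sup>/\<^sup>2 = u\<close>, \<open>q\<^sup>1\<^sup>/\<^sup>2 = v\<close>. One definition serves two purposes: the points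
  \<open>(\<alpha>\<^sup>d, s\<^sup>d)\<close> describe the substitution of powers, and the point \<open>(\<alpha>, 1)\<close> the limit \<open>q \<rightarrow> 1\<close>.
\<close>

definition bieval :: "'a::field_char_0 \<Rightarrow> 'a \<Rightarrow> int poly poly \<Rightarrow> 'a" where
  "bieval u v p = poly (map_poly (\<lambda>c. poly (map_poly of_int c) v) p) u"

lemma bieval_0 [simp]: "bieval u v 0 = 0" and bieval_1 [simp]: "bieval u v 1 = 1"
  by (simp_all add: bieval_def)

lemma bieval_add: "bieval u v (p + q) = bieval u v p + bieval u v q"
  unfolding bieval_def by (subst map_poly_plus_hom) (simp_all add: map_poly_plus_hom)

lemma bieval_mult: "bieval u v (p * q) = bieval u v p * bieval u v q"
  unfolding bieval_def
  by (subst map_poly_times_hom) (simp_all add: map_poly_plus_hom map_poly_times_hom)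

lemma bieval_uminus: "bieval u v (- p) = - bieval u v p"
  using bieval_add[of u v p "- p"] by (simp add: add_eq_0_iff)

text \<open>
  \<open>F\<close> is regular at the point \<open>(u, v)\<close> and has the value \<open>w\<close> there. As a relation rather than a
  function it carries the regularity along, and the lemmas below say that the regular functions form
  a local ring with a ring homomorphism to the target field.
\<close>

definition specialises :: "'a::field_char_0 \<Rightarrow> 'a \<Rightarrow> ratfun \<Rightarrow> 'a \<Rightarrow> bool" where
  "specialises u v F w \<longleftrightarrow>
     (\<exists>p q. bieval u v q \<noteq> 0 \<and> F = Fract p q \<and> w = bieval u v p / bieval u v q)"

lemma specialises_unique:
  assumes "specialises u v F w" "specialises u v F w'"
  shows "w = w'"
proof -
  from assms obtain p q p' q' where
    q: "bieval u v q \<noteq> 0" "F = Fract p q" "w = bieval u v p / bieval u v q" and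
    q': "bieval u v q' \<noteq> 0" "F = Fract p' q'" "w' = bieval u v p' / bieval u v q'"
    unfolding specialises_def by blast
  have "q \<noteq> 0" "q' \<noteq> 0" using q(1) q'(1) by auto
  then have "p * q' = p' * q" using q(2) q'(2) by (simp add: eq_fract)
  then have "bieval u v p * bieval u v q' = bieval u v p' * bieval u v q"
    by (metis bieval_mult)
  then show ?thesis by (simp add: q(3) q'(3) frac_eq_eq[OF q(1) q'(1)])
qed

lemma specialises_ah: "specialises u v ah u"
  unfolding specialises_def ah_def
  by (rule exI[of _ "[:0, 1:]"], rule exI[of _ 1]) (simp add: bieval_def map_poly_pCons)

lemma specialises_qh: "specialises u v qh v"
  unfolding specialises_def qh_def
  by (rule exI[of _ "[:[:0, 1:]:]"], rule exI[of _ 1]) (simp add: bieval_def map_poly_pCons)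

lemma specialises_0: "specialises u v 0 0"
  unfolding specialises_def Zero_fract_def
  by (rule exI[of _ 0], rule exI[of _ 1]) simp

lemma specialises_1: "specialises u v 1 1"
  unfolding specialises_def One_fract_def
  by (rule exI[of _ 1], rule exI[of _ 1]) simp

lemma specialises_add:
  assumes "specialises u v F w" "specialises u v F' w'"
  shows "specialises u v (F + F') (w + w')"
proof -
  from assms obtain p q p' q' where
    q: "bieval u v q \<noteq> 0" "F = Fract p q" "w = bieval u v p / bieval u v q" and
    q': "bieval u v q' \<noteq> 0" "F' = Fract p' q'" "w' = bieval u v p' / bieval u v q'"
    unfolding specialises_def by blast
  have "q \<noteq> 0" "q' \<noteq> 0" using q(1) q'(1) by auto
  then show ?thesis unfolding specialises_def using q q'
    by (intro exI[of _ "p * q' + p' * q"] exI[of _ "q * q'"])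
       (simp add: bieval_add bieval_mult add_frac_eq)
qed

lemma specialises_mult:
  assumes "specialises u v F w" "specialises u v F' w'"
  shows "specialises u v (F * F') (w * w')"
proof -
  from assms obtain p q p' q' where
    q: "bieval u v q \<noteq> 0" "F = Fract p q" "w = bieval u v p / bieval u v q" and
    q': "bieval u v q' \<noteq> 0" "F' = Fract p' q'" "w' = bieval u v p' / bieval u v q'"
    unfolding specialises_def by blast
  then show ?thesis unfolding specialises_def
    by (intro exI[of _ "p * p'"] exI[of _ "q * q'"]) (simp add: bieval_mult)
qed

lemma specialises_uminus: "specialises u v F w \<Longrightarrow> specialises u v (- F) (- w)"
  unfolding specialises_def by (metis bieval_uminus minus_divide_left minus_fract)

lemma specialises_diff:
  "specialises u v F w \<Longrightarrow> specialises u v F' w' \<Longrightarrow> specialises u v (F - F') (w - w')"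
  using specialises_add[of u v F w "- F'" "- w'"] by (simp add: specialises_uminus)

lemma specialises_inverse:
  assumes "specialises u v F w" "w \<noteq> 0"
  shows "specialises u v (inverse F) (inverse w)"
proof -
  from assms obtain p q where
    q: "bieval u v q \<noteq> 0" "F = Fract p q" "w = bieval u v p / bieval u v q"
    unfolding specialises_def by blast
  then show ?thesis unfolding specialises_def using assms(2)
    by (intro exI[of _ q] exI[of _ p]) auto
qed

lemma specialises_divide:
  "specialises u v F w \<Longrightarrow> specialises u v F' w' \<Longrightarrow> w' \<noteq> 0 \<Longrightarrow> specialises u v (F / F') (w / w')"
  unfolding divide_inverse by (intro specialises_mult specialises_inverse)

lemma specialises_power: "specialises u v F w \<Longrightarrow> specialises u v (F ^ n) (w ^ n)"
  by (induction n) (simp_all add: specialises_1 specialises_mult)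

lemma specialises_powi:
  "specialises u v F w \<Longrightarrow> w \<noteq> 0 \<Longrightarrow> specialises u v (F powi k) (w powi k)"
  by (auto simp: power_int_def intro!: specialises_power specialises_inverse)

lemma specialises_sum:
  "(\<And>x. x \<in> A \<Longrightarrow> specialises u v (F x) (w x)) \<Longrightarrow> specialises u v (sum F A) (sum w A)"
  by (induction A rule: infinite_finite_induct) (simp_all add: specialises_0 specialises_add)

lemma specialises_of_nat: "specialises u v (of_nat n) (of_nat n)"
  by (induction n) (simp_all add: specialises_0 specialises_1 specialises_add)

lemma specialises_of_int: "specialises u v (of_int k) (of_int k)"
  by (cases k) (simp_all add: specialises_of_nat specialises_uminus
    specialises_add specialises_1 specialises_diff del: of_nat_Suc)

text \<open>
  The substitution of powers is defined through a fraction in lowest terms. The denominator of such a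
  fraction divides every other denominator, so it does not vanish at the point as soon as one
  denominator does not.
\<close>

lemma subst_powers_eqI:
  assumes "specialises (ah ^ d) (qh ^ d) F w"
  shows "subst_powers d F = w"
proof -
  from assms obtain p q where
    q: "bieval (ah ^ d) (qh ^ d) q \<noteq> 0" and F: "F = Fract p q"
    unfolding specialises_def by blast
  define p' q' where "p' = fst (quot_of_fract F)" and "q' = snd (quot_of_fract F)"
  have F': "F = Fract p' q'" by (simp add: p'_def q'_def)
  have "q' \<noteq> 0" "q \<noteq> 0" using q by (auto simp: q'_def)
  then have "p * q' = p' * q" using F F' by (simp add: eq_fract)
  moreover have "coprime p' q'" by (simp add: p'_def q'_def coprime_quot_of_fract)
  ultimately have "q' dvd q"
    by (metis coprime_commute coprime_dvd_mult_right_iff dvd_triv_right)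
  then have "bieval (ah ^ d) (qh ^ d) q' \<noteq> 0" using q
    by (metis bieval_mult dvdE mult_zero_left)
  then have "specialises (ah ^ d) (qh ^ d) F (bieval (ah ^ d) (qh ^ d) p' / bieval (ah ^ d) (qh ^ d) q')"
    unfolding specialises_def using F' by blast
  moreover have "subst_powers d F = bieval (ah ^ d) (qh ^ d) p' / bieval (ah ^ d) (qh ^ d) q'"
    by (simp add: subst_powers_def poly_subst_powers_def bieval_def p'_def q'_def)
  ultimately show ?thesis using assms specialises_unique by metis
qed

section \<open>Independence of the monomials in the two variables\<close>

lemma ah_nonzero [simp]: "ah \<noteq> 0" and qh_nonzero [simp]: "qh \<noteq> 0"
  by (simp_all add: ah_def qh_def Zero_fract_def eq_fract)

lemma add_fract_whole: "Fract (p + p') 1 = Fract p 1 + Fract p' 1"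
  by simp

lemma Fract_sum: "Fract (sum g A) 1 = (\<Sum>x\<in>A. Fract (g x) 1)"
  by (induction A rule: infinite_finite_induct)
     (simp_all add: Zero_fract_def[symmetric] add_fract_whole del: add_fract)

lemma of_int_times_monomial:
  "of_int c * ah ^ j * qh ^ l = Fract (monom (monom c l) j) 1"
proof -
  have "of_int c = (Fract (of_int c) 1 :: ratfun)"
    by (cases c rule: int_diff_cases) (simp add: of_nat_fract)
  then have 1: "of_int c = Fract [:[:c:]:] 1"
    by (simp add: of_int_poly)
  have 2: "ah ^ j = Fract (monom 1 j) 1"
    by (induction j) (simp_all add: One_fract_def ah_def monom_Suc)
  have 3: "qh ^ l = Fract [:monom 1 l:] 1"
    by (induction l) (simp_all add: One_fract_def qh_def monom_Suc pCons_one)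
  have "[:[:c:]:] * monom 1 j * [:monom 1 l:] = [:[:c:]:] * ([:monom 1 l:] * monom 1 j)"
    by (simp only: mult_ac)
  also have "\<dots> = monom (monom c l) j"
    by (simp add: smult_monom)
  finally show ?thesis unfolding 1 2 3 mult_fract by simp
qed

lemma monomials_independent_int:
  fixes c :: "nat \<times> nat \<Rightarrow> int"
  assumes "finite S" "(\<Sum>(j, l)\<in>S. of_int (c (j, l)) * ah ^ j * qh ^ l) = 0" "x \<in> S"
  shows "c x = 0"
proof -
  obtain j l where x: "x = (j, l)" by force
  define P where "P = (\<Sum>(j, l)\<in>S. monom (monom (c (j, l)) l) j)"
  have "Fract P 1 = 0"
    using assms(2) by (simp add: of_int_times_monomial P_def Fract_sum case_prod_beta)
  then have "P = 0" by (simp add: Zero_fract_def eq_fract)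
  then have "0 = coeff (coeff P j) l" by simp
  also have "\<dots> = (\<Sum>y\<in>S. if y = x then c y else 0)"
    unfolding P_def x coeff_sum by (intro sum.cong) (auto simp: case_prod_beta)
  also have "\<dots> = c x" using assms by simp
  finally show ?thesis by simp
qed

lemma common_denominator:
  assumes "finite S"
  shows "\<exists>D::int. D > 0 \<and> (\<forall>x\<in>S. \<exists>z::int. of_int D * c x = (of_int z :: rat))"
  using assms
proof induction
  case (insert y S)
  then obtain D where D: "D > 0" "\<forall>x\<in>S. \<exists>z::int. of_int D * c x = (of_int z :: rat)"
    by (elim exE conjE)
  obtain a b where ab: "c y = Rat.Fract a b" "b > 0" by (cases "c y") auto
  have "of_int (b * D) * c y = of_int (a * D)"
    using ab by (simp add: Fract_of_int_quotient)
  moreover have "\<exists>z::int. of_int (b * D) * c x = (of_int z :: rat)" if "x \<in> S" for x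
  proof -
    from bspec[OF D(2) that] obtain z where "of_int D * c x = (of_int z :: rat)" ..
    then have "of_int (b * D) * c x = (of_int (b * z) :: rat)"
      by (simp only: of_int_mult mult.assoc)
    then show ?thesis ..
  qed
  ultimately have "b * D > 0 \<and> (\<forall>x\<in>insert y S. \<exists>z::int. of_int (b * D) * c x = (of_int z :: rat))"
    using D(1) ab(2) by (metis insert_iff mult_pos_pos)
  then show ?case ..
qed (auto intro: exI[of _ 1])

text \<open>
  Clearing denominators and shifting exponents reduces this to polynomials with integer coefficients,
  whose coefficients can be read off.
\<close>

lemma monomials_independent:
  fixes c :: "int \<times> int \<Rightarrow> rat"
  assumes fin: "finite S" and zero: "(\<Sum>(j, l)\<in>S. of_rat (c (j, l)) * ah powi j * qh powi l) = 0"
    and x: "x \<in> S"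
  shows "c x = 0"
proof -
  obtain D where D: "D > 0" "\<forall>x\<in>S. \<exists>z::int. of_int D * c x = (of_int z :: rat)"
    using common_denominator[OF fin] by blast
  then obtain z where z: "of_int D * c x = (of_int (z x) :: rat)" if "x \<in> S" for x
    by metis
  obtain K where K: "\<bar>j\<bar> \<le> K" "\<bar>l\<bar> \<le> K" if "(j, l) \<in> S" for j l
  proof
    fix j l assume "(j, l) \<in> S"
    then have "\<bar>j\<bar> + \<bar>l\<bar> \<le> (\<Sum>(j, l)\<in>S. \<bar>j\<bar> + \<bar>l\<bar>)"
      using fin member_le_sum[of "(j, l)" S "\<lambda>(j, l). \<bar>j\<bar> + \<bar>l\<bar>"] by auto
    then show "\<bar>j\<bar> \<le> (\<Sum>(j, l)\<in>S. \<bar>j\<bar> + \<bar>l\<bar>)" "\<bar>l\<bar> \<le> (\<Sum>(j, l)\<in>S. \<bar>j\<bar> + \<bar>l\<bar>)"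
      by linarith+
  qed
  define \<phi> where "\<phi> = (\<lambda>(j, l). (nat (j + K), nat (l + K)))"
  define \<psi> where "\<psi> = (\<lambda>(j, l). (int j - K, int l - K))"
  have inv: "\<psi> (\<phi> y) = y" if "y \<in> S" for y
    using K[of "fst y" "snd y"] that by (auto simp: \<phi>_def \<psi>_def case_prod_beta)
  then have inj: "inj_on \<phi> S" by (rule inj_on_inverseI)
  have "(\<Sum>(j, l)\<in>\<phi> ` S. of_int ((z \<circ> \<psi>) (j, l)) * ah ^ j * qh ^ l) =
        (\<Sum>y\<in>S. case \<phi> y of (j, l) \<Rightarrow> of_int ((z \<circ> \<psi>) (j, l)) * ah ^ j * qh ^ l)"
    using inj by (simp add: sum.reindex)
  also have "\<dots> = (\<Sum>(j, l)\<in>S. of_int D * ah powi K * qh powi K * (of_rat (c (j, l)) * ah powi j * qh powi l))"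
  proof (intro sum.cong refl, clarify)
    fix j l assume jl: "(j, l) \<in> S"
    have "of_int (z (j, l)) = (of_int D * of_rat (c (j, l)) :: ratfun)"
      using z[OF jl] by (metis of_rat_mult of_rat_of_int_eq)
    moreover have "w ^ nat (i + K) = w powi K * w powi i" if "w \<noteq> 0" "\<bar>i\<bar> \<le> K" for i and w :: ratfun
    proof -
      have "w ^ nat (i + K) = w powi (i + K)" using that(2) by (simp add: power_int_def)
      then show ?thesis using that(1) by (simp add: power_int_add)
    qed
    note this[OF ah_nonzero K(1)[OF jl]] this[OF qh_nonzero K(2)[OF jl]]
    moreover have "(z \<circ> \<psi>) (\<phi> (j, l)) = z (j, l)" using inv[OF jl] by simp
    ultimately show "(case \<phi> (j, l) of (j, l) \<Rightarrow> of_int ((z \<circ> \<psi>) (j, l)) * ah ^ j * qh ^ l) =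
       of_int D * ah powi K * qh powi K * (of_rat (c (j, l)) * ah powi j * qh powi l)"
      by (simp add: \<phi>_def mult_ac)
  qed
  also have "\<dots> = of_int D * ah powi K * qh powi K *
      (\<Sum>(j, l)\<in>S. of_rat (c (j, l)) * ah powi j * qh powi l)"
    by (simp add: sum_distrib_left case_prod_beta)
  finally have "(\<Sum>(j, l)\<in>\<phi> ` S. of_int ((z \<circ> \<psi>) (j, l)) * ah ^ j * qh ^ l) = 0"
    using zero by simp
  from monomials_independent_int[OF _ this, of "\<phi> x"] have "z x = 0"
    using fin x inv by auto
  then show ?thesis using z[OF x] D(1) by simp
qed

section \<open>Divisibility, units and evaluation of Laurent polynomials\<close>

text \<open>
  The lexicographic order makes the exponent vectors an ordered group. It yields that the Laurent
  polynomials form a domain, and it provides the extreme exponents that determine the units.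
\<close>

instance prod :: ("{ordered_cancel_comm_monoid_add, linorder}", "{ordered_cancel_comm_monoid_add, linorder}")
  ordered_cancel_comm_monoid_add
proof
  fix a b c :: "'a \<times> 'b"
  assume "a \<le> b"
  then show "c + a \<le> c + b"
    by (auto simp: less_eq_prod_def add_strict_left_mono add_left_mono)
qed

lemma poly_mapping_sum_single:
  "p = (\<Sum>k\<in>Poly_Mapping.keys p. Poly_Mapping.single k (Poly_Mapping.lookup p k))"
  by (rule poly_mapping_eqI) (auto simp: lookup_sum lookup_single when_def in_keys_iff)

lemma poly_mapping_additive_induct:
  fixes p :: "'k \<Rightarrow>\<^sub>0 'v::comm_monoid_add"
  assumes "P 0" "\<And>k c. P (Poly_Mapping.single k c)" "\<And>p q. P p \<Longrightarrow> P q \<Longrightarrow> P (p + q)"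
  shows "P p"
proof -
  have "P (\<Sum>k\<in>A. Poly_Mapping.single k (Poly_Mapping.lookup p k))" for A
    by (induction A rule: infinite_finite_induct) (simp_all add: assms)
  then show ?thesis by (metis poly_mapping_sum_single)
qed

lemma lookup_mult_unique_pair:
  fixes p p' :: "'k::{cancel_ab_semigroup_add, comm_monoid_add} \<Rightarrow>\<^sub>0 'v::semiring_0"
  assumes a: "a \<in> Poly_Mapping.keys p" and b: "b \<in> Poly_Mapping.keys p'"
    and unique: "\<And>x y. x \<in> Poly_Mapping.keys p \<Longrightarrow> y \<in> Poly_Mapping.keys p' \<Longrightarrow> x + y = a + b \<Longrightarrow> x = a"
  shows "Poly_Mapping.lookup (p * p') (a + b) = Poly_Mapping.lookup p a * Poly_Mapping.lookup p' b"
proof -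
  let ?K = "Poly_Mapping.keys p" and ?K' = "Poly_Mapping.keys p'"
  have "p * p' = (\<Sum>x\<in>?K. Poly_Mapping.single x (Poly_Mapping.lookup p x)) *
                 (\<Sum>y\<in>?K'. Poly_Mapping.single y (Poly_Mapping.lookup p' y))"
    using poly_mapping_sum_single[of p] poly_mapping_sum_single[of p'] by simp
  also have "\<dots> = (\<Sum>x\<in>?K. \<Sum>y\<in>?K'. Poly_Mapping.single (x + y) (Poly_Mapping.lookup p x * Poly_Mapping.lookup p' y))"
    by (simp add: sum_product mult_single)
  finally have "Poly_Mapping.lookup (p * p') (a + b) =
      (\<Sum>x\<in>?K. \<Sum>y\<in>?K'. if x + y = a + b then Poly_Mapping.lookup p x * Poly_Mapping.lookup p' y else 0)"
    by (simp add: lookup_sum lookup_single when_def)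
  also have "\<dots> = (\<Sum>x\<in>?K. \<Sum>y\<in>?K'. if x = a \<and> y = b then Poly_Mapping.lookup p x * Poly_Mapping.lookup p' y else 0)"
    using unique by (intro sum.cong refl) (auto dest: unique)
  also have "\<dots> = (\<Sum>x\<in>?K. if x = a then \<Sum>y\<in>?K'. if y = b then Poly_Mapping.lookup p x * Poly_Mapping.lookup p' y else 0 else 0)"
    by (intro sum.cong refl) auto
  also have "\<dots> = Poly_Mapping.lookup p a * Poly_Mapping.lookup p' b"
    using a b by simp
  finally show ?thesis .
qed

lemma add_eq_imp_eq_left:
  fixes a b x y :: "'k::{ordered_cancel_comm_monoid_add, linorder}"
  assumes "x \<le> a" "y \<le> b" "x + y = a + b"
  shows "x = a"
  using assms add_less_le_mono[of x a y b] by (auto simp: order_le_less)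

text \<open>
  The largest exponents of \<open>h\<close> and \<open>h'\<close> add up to the exponent 0 of the product, and so do the smallest
  ones. Hence largest and smallest exponent of \<open>h\<close> agree.
\<close>

lemma laurent_unit_is_monomial:
  fixes h h' :: "'k::{ordered_cancel_comm_monoid_add, linorder} \<Rightarrow>\<^sub>0 rat"
  assumes "h * h' = 1"
  shows "\<exists>e c. c \<noteq> 0 \<and> h = Poly_Mapping.single e c"
proof -
  let ?K = "Poly_Mapping.keys h" and ?K' = "Poly_Mapping.keys h'"
  have ne: "?K \<noteq> {}" "?K' \<noteq> {}" using assms by auto
  have max: "Max ?K + Max ?K' = 0"
  proof -
    have "Poly_Mapping.lookup (h * h') (Max ?K + Max ?K') =
          Poly_Mapping.lookup h (Max ?K) * Poly_Mapping.lookup h' (Max ?K')"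
      using ne by (intro lookup_mult_unique_pair)
        (simp_all, meson Max_ge add_eq_imp_eq_left finite_keys)
    moreover have "\<dots> \<noteq> 0" using ne Max_in[of ?K] Max_in[of ?K'] by (simp add: in_keys_iff)
    ultimately show ?thesis using assms by (auto simp: lookup_one when_def split: if_splits)
  qed
  have min: "Min ?K + Min ?K' = 0"
  proof -
    have "Poly_Mapping.lookup (h * h') (Min ?K + Min ?K') =
          Poly_Mapping.lookup h (Min ?K) * Poly_Mapping.lookup h' (Min ?K')"
      using ne by (intro lookup_mult_unique_pair)
        (simp_all, metis Min_le add_eq_imp_eq_left finite_keys)
    moreover have "\<dots> \<noteq> 0" using ne Min_in[of ?K] Min_in[of ?K'] by (simp add: in_keys_iff)
    ultimately show ?thesis using assms by (auto simp: lookup_one when_def split: if_splits)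
  qed
  have "Min ?K \<le> Max ?K" "Min ?K' \<le> Max ?K'" using ne by simp_all
  then have "Min ?K = Max ?K"
    using min max add_eq_imp_eq_left[of "Min ?K" "Max ?K" "Min ?K'" "Max ?K'"] by simp
  then have "x = Max ?K" if "x \<in> ?K" for x
    using Max_ge[OF _ that] Min_le[OF _ that] by simp
  then have K: "?K = {Max ?K}" using Max_in[of ?K] ne by blast
  have "h = (\<Sum>k\<in>{Max ?K}. Poly_Mapping.single k (Poly_Mapping.lookup h k))"
    using poly_mapping_sum_single[of h] by (simp only: flip: K)
  then have "h = Poly_Mapping.single (Max ?K) (Poly_Mapping.lookup h (Max ?K))"
    by simp
  moreover have "Poly_Mapping.lookup h (Max ?K) \<noteq> 0"
    using ne Max_in[of ?K] by (simp add: in_keys_iff)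
  ultimately show ?thesis by blast
qed

text \<open>
  Truncation in the degree of \<open>a\<^sup>1\<^sup>/\<^sup>2\<close>, the second variable.
\<close>

definition a_part_below :: "int \<Rightarrow> laurent3 \<Rightarrow> laurent3" where
  "a_part_below K = Poly_Mapping.mapp (\<lambda>(i, j, k) c. if j < K then c else 0)"

lemma lookup_a_part_below:
  "Poly_Mapping.lookup (a_part_below K p) (i, j, k) = (if j < K then Poly_Mapping.lookup p (i, j, k) else 0)"
  by (auto simp: a_part_below_def lookup_mapp when_def in_keys_iff)

lemma a_part_below_add: "a_part_below K (p + p') = a_part_below K p + a_part_below K p'"
  by (rule poly_mapping_eqI) (auto simp: lookup_a_part_below lookup_add split: prod.splits)

lemma a_part_below_0: "a_part_below K 0 = 0"
  by (rule poly_mapping_eqI) (auto simp: lookup_a_part_below)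

lemma a_part_below_single:
  "a_part_below K (Poly_Mapping.single (i, j, k) c) = (if j < K then Poly_Mapping.single (i, j, k) c else 0)"
  by (rule poly_mapping_eqI) (auto simp: lookup_a_part_below lookup_single when_def split_paired_all)

lemma a_part_below_mult:
  assumes "\<And>i j k. (i, j, k) \<in> Poly_Mapping.keys c \<Longrightarrow> j = 0"
  shows "a_part_below K (c * p) = c * a_part_below K p"
proof -
  have single: "a_part_below K (Poly_Mapping.single (i, 0, k) x * p) =
        Poly_Mapping.single (i, 0, k) x * a_part_below K p" for i k x
    by (induction p rule: poly_mapping_additive_induct)
       (auto simp: a_part_below_0 a_part_below_add distrib_left mult_single a_part_below_single split_paired_all)
  have "a_part_below K ((\<Sum>e\<in>A. Poly_Mapping.single e (Poly_Mapping.lookup c e)) * p) =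
        (\<Sum>e\<in>A. Poly_Mapping.single e (Poly_Mapping.lookup c e)) * a_part_below K p"
    if "A \<subseteq> Poly_Mapping.keys c" for A
    using that
  proof (induction A rule: infinite_finite_induct)
    case (insert e A)
    obtain i j k where e: "e = (i, j, k)" by (cases e)
    then have "j = 0" using insert.prems assms by auto
    then show ?case using insert e by (simp add: distrib_right a_part_below_add single)
  qed (simp_all add: a_part_below_0)
  from this[OF order_refl] show ?thesis by (simp flip: poly_mapping_sum_single)
qed

lemma single_1_power:
  "Poly_Mapping.single (i :: int, j :: int, k :: int) (1 :: rat) ^ n =
     Poly_Mapping.single (int n * i, int n * j, int n * k) 1"
  by (induction n) (simp_all add: mult_single algebra_simps flip: single_one zero_prod_def)

text \<open>
  Let \<open>m\<close> be the monomial. Multiplying \<open>(1 - m) b = c g\<close> by a geometric sum gives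
  \<open>b = c g' + m\<^sup>N b\<close>. For large \<open>N\<close> all terms of \<open>m\<^sup>N b\<close> have higher degree in \<open>a\<^sup>1\<^sup>/\<^sup>2\<close> than those of \<open>b\<close>,
  and since \<open>c\<close> has degree 0, truncation leaves \<open>b\<close> on the left and a multiple of \<open>c\<close> on the right.
\<close>

lemma dvd_if_dvd_one_minus_monomial_mult:
  fixes b c :: laurent3
  assumes c: "\<And>i j k. (i, j, k) \<in> Poly_Mapping.keys c \<Longrightarrow> j = 0"
    and j: "j > 0" and dvd: "c dvd (1 - Poly_Mapping.single (i, j, k) 1) * b"
  shows "c dvd b"
proof -
  define m :: laurent3 where "m = Poly_Mapping.single (i, j, k) 1"
  obtain g where g: "(1 - m) * b = c * g" using dvd by (auto simp: m_def)
  define K where "K = (\<Sum>(i, j, k)\<in>Poly_Mapping.keys b. \<bar>j\<bar>) + 1"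
  have K: "\<bar>j'\<bar> < K" if "(i', j', k') \<in> Poly_Mapping.keys b" for i' j' k'
    using member_le_sum[OF that, of "\<lambda>(i, j, k). \<bar>j\<bar>"] by (auto simp: K_def)
  have "K > 0" by (auto simp: K_def intro!: add_nonneg_pos sum_nonneg)
  \<comment> \<open>The degrees of \<open>b\<close> lie strictly between \<open>-K\<close> and \<open>K\<close>, so a shift by \<open>2 K\<close> separates \<open>b\<close> from its
    translate.\<close>
  define N where "N = nat (2 * K)"
  have low: "a_part_below K b = b"
    using K by (intro poly_mapping_eqI) (force simp: lookup_a_part_below in_keys_iff)
  have high: "a_part_below K (m ^ N * b) = 0"
  proof (rule poly_mapping_eqI, clarify)
    fix i' j' k'
    have "j' \<ge> K" if key: "(i', j', k') \<in> Poly_Mapping.keys (m ^ N * b)"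
    proof -
      obtain x y z where xyz: "(x, y, z) \<in> Poly_Mapping.keys b" "j' = int N * j + y"
        using subsetD[OF keys_mult key] by (auto simp: m_def single_1_power)
      have "int N = 2 * K" using \<open>K > 0\<close> by (simp add: N_def)
      moreover have "int N * 1 \<le> int N * j" using j by (intro mult_left_mono) auto
      ultimately show ?thesis using K[OF xyz(1)] xyz(2) \<open>K > 0\<close> by linarith
    qed
    then have "Poly_Mapping.lookup (m ^ N * b) (i', j', k') = 0" if "j' < K"
      using that by (metis in_keys_iff not_less)
    then show "Poly_Mapping.lookup (a_part_below K (m ^ N * b)) (i', j', k') = Poly_Mapping.lookup 0 (i', j', k')"
      by (simp add: lookup_a_part_below)
  qed
  have "b = (1 - m ^ N) * b + m ^ N * b" by (simp add: algebra_simps)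
  also have "(1 - m ^ N) * b = c * (g * (\<Sum>i<N. m ^ i))"
    using g by (simp add: one_diff_power_eq mult_ac)
  finally have "b = c * (g * (\<Sum>i<N. m ^ i)) + m ^ N * b" .
  then have "a_part_below K b = a_part_below K (c * (g * (\<Sum>i<N. m ^ i)) + m ^ N * b)"
    by (rule arg_cong)
  also have "\<dots> = c * a_part_below K (g * (\<Sum>i<N. m ^ i)) + a_part_below K (m ^ N * b)"
    by (simp only: a_part_below_add a_part_below_mult[OF c])
  finally have "b = c * a_part_below K (g * (\<Sum>i<N. m ^ i))"
    by (simp only: low high add_0_right)
  then show ?thesis by (rule dvdI)
qed

lemma laurent3_eval_add: "laurent3_eval (p + p') u v w = laurent3_eval p u v w + laurent3_eval p' u v w"
  unfolding laurent3_eval_def case_prod_unfold prod.collapse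
  by (rule setsum_keys_plus_distrib) (simp_all add: of_rat_add algebra_simps)

lemma laurent3_eval_0 [simp]: "laurent3_eval 0 u v w = 0"
  by (simp add: laurent3_eval_def)

lemma laurent3_eval_single:
  "laurent3_eval (Poly_Mapping.single (i, j, k) c) u v w = of_rat c * u powi i * v powi j * w powi k"
  by (simp add: laurent3_eval_def)

lemma laurent3_eval_uminus: "laurent3_eval (- p) u v w = - laurent3_eval p u v w"
  using laurent3_eval_add[of p "- p" u v w] by (simp add: add_eq_0_iff)

lemma laurent3_eval_diff: "laurent3_eval (p - p') u v w = laurent3_eval p u v w - laurent3_eval p' u v w"
  using laurent3_eval_add[of p "- p'" u v w] by (simp add: laurent3_eval_uminus)

lemma laurent3_eval_mult:
  assumes "u \<noteq> 0" "v \<noteq> 0" "w \<noteq> 0"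
  shows "laurent3_eval (p * p') u v w = laurent3_eval p u v w * laurent3_eval p' u v w"
proof (induction p rule: poly_mapping_additive_induct)
  case (2 e c)
  obtain i j k where e: "e = (i, j, k)" by (cases e)
  show ?case
  proof (induction p' rule: poly_mapping_additive_induct)
    case (2 e' c')
    obtain i' j' k' where "e' = (i', j', k')" by (cases e')
    then show ?case using assms
      by (simp add: e mult_single laurent3_eval_single of_rat_mult power_int_add)
  qed (simp_all add: distrib_left laurent3_eval_add)
qed (simp_all add: distrib_right laurent3_eval_add)

text \<open>
  At \<open>M = s\<^sup>n\<close> the monomial with exponents \<open>(i, j, k)\<close> becomes \<open>\<alpha>\<^sup>j s\<^bsup>n i + k\<^esup>\<close>. Once \<open>n\<close> exceeds all
  differences of the occurring \<open>k\<close>, distinct exponent vectors give distinct monomials, and these are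
  independent.
\<close>

lemma laurent3_eq_0_if_eval_eq_0:
  assumes inf: "infinite {n. laurent3_eval p (qh ^ n) ah qh = 0}"
  shows "p = 0"
proof (rule ccontr)
  assume "p \<noteq> 0"
  then have "Poly_Mapping.keys p \<noteq> {}" by simp
  then obtain x where x: "x \<in> Poly_Mapping.keys p" by blast
  define K where "K = (\<Sum>(i, j, k)\<in>Poly_Mapping.keys p. \<bar>k\<bar>) + 1"
  have K: "\<bar>k\<bar> < K" if "(i, j, k) \<in> Poly_Mapping.keys p" for i j k
    using member_le_sum[OF that, of "\<lambda>(i, j, k). \<bar>k\<bar>"] by (auto simp: K_def)
  have "\<exists>n>nat (2 * K). n \<in> {n. laurent3_eval p (qh ^ n) ah qh = 0}"
    using inf unfolding infinite_nat_iff_unbounded by (rule spec)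
  then obtain n where n: "n > nat (2 * K)" "laurent3_eval p (qh ^ n) ah qh = 0"
    unfolding mem_Collect_eq by (elim exE conjE)
  define \<phi> where "\<phi> = (\<lambda>(i, j :: int, k). (j, int n * i + k))"
  have inj: "inj_on \<phi> (Poly_Mapping.keys p)"
  proof (rule inj_onI)
    fix y z assume y: "y \<in> Poly_Mapping.keys p" and z: "z \<in> Poly_Mapping.keys p" and eq: "\<phi> y = \<phi> z"
    obtain i j k i' j' k' where [simp]: "y = (i, j, k)" "z = (i', j', k')" by (cases y, cases z)
    have jj: "j = j'" and ik: "int n * i + k = int n * i' + k'" using eq by (auto simp: \<phi>_def)
    have "int n * (i - i') = k' - k"
      using ik by (simp add: right_diff_distrib)
    then have "\<bar>int n * (i - i')\<bar> = \<bar>k' - k\<bar>" by (rule arg_cong)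
    then have "int n * \<bar>i - i'\<bar> = \<bar>k' - k\<bar>" by (simp only: abs_mult abs_of_nat)
    also have "\<dots> < 2 * K" using K[of i j k] K[of i' j' k'] y z by simp
    also have "\<dots> < int n" using n by linarith
    finally have "\<bar>i - i'\<bar> < 1" using mult_less_cancel_left_pos[of "int n" "\<bar>i - i'\<bar>" 1] n(1) by simp
    then show "y = z" using ik jj by simp
  qed
  define c where "c = Poly_Mapping.lookup p \<circ> inv_into (Poly_Mapping.keys p) \<phi>"
  have "0 = laurent3_eval p (qh ^ n) ah qh" using n by simp
  also have "\<dots> = (\<Sum>y\<in>Poly_Mapping.keys p. case \<phi> y of (j, l) \<Rightarrow> of_rat (c (j, l)) * ah powi j * qh powi l)"
    unfolding laurent3_eval_def
  proof (intro sum.cong refl, clarify)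
    fix i j k assume "(i, j, k) \<in> Poly_Mapping.keys p"
    then have "c (j, int n * i + k) = Poly_Mapping.lookup p (i, j, k)"
      using inv_into_f_f[OF inj, of "(i, j, k)"] by (simp add: c_def \<phi>_def)
    then show "of_rat (Poly_Mapping.lookup p (i, j, k)) * (qh ^ n) powi i * ah powi j * qh powi k =
      (case \<phi> (i, j, k) of (j, l) \<Rightarrow> of_rat (c (j, l)) * ah powi j * qh powi l)"
      by (simp add: \<phi>_def power_int_add power_int_mult)
  qed
  also have "\<dots> = (\<Sum>(j, l)\<in>\<phi> ` Poly_Mapping.keys p. of_rat (c (j, l)) * ah powi j * qh powi l)"
    using inj by (simp add: sum.reindex)
  finally have "c (\<phi> x) = 0"
    using x by (intro monomials_independent[of "\<phi> ` Poly_Mapping.keys p"]) auto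
  then show False using x inv_into_f_f[OF inj x] by (simp add: c_def in_keys_iff)
qed

lemma ah_qh_monomial_eqD:
  assumes "ah powi j * qh powi l = ah powi j' * qh powi l'"
  shows "j = j' \<and> l = l'"
proof (rule ccontr)
  assume neq: "\<not> (j = j' \<and> l = l')"
  define c :: "int \<times> int \<Rightarrow> rat" where "c = (\<lambda>x. if x = (j, l) then 1 else - 1)"
  have ne: "(j, l) \<noteq> (j', l')" using neq by simp
  then have c: "c (j, l) = 1" "c (j', l') = - 1" by (auto simp: c_def)
  have "(\<Sum>(j, l)\<in>{(j, l), (j', l')}. of_rat (c (j, l)) * ah powi j * qh powi l) =
      of_rat (c (j, l)) * (ah powi j * qh powi l) + of_rat (c (j', l')) * (ah powi j' * qh powi l')"
    using ne by (simp add: mult.assoc)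
  also have "\<dots> = 0" by (simp only: c assms of_rat_minus of_rat_1 mult_minus_left right_minus)
  finally have "(\<Sum>(j, l)\<in>{(j, l), (j', l')}. of_rat (c (j, l)) * ah powi j * qh powi l) = 0" .
  from monomials_independent[OF _ this, of "(j, l)"] show False by (simp add: c_def)
qed

section \<open>The dual A-polynomial\<close>

text \<open>
  The coefficients of the explicit operator of order one: \<open>s M - s\<^sup>-\<^sup>1 M\<^sup>-\<^sup>1\<close> in front of \<open>L\<close>, and
  the negative of \<open>(-1)\<^sup>\<tau> M\<^bsup>2\<tau>\<^esup> (\<alpha> M - \<alpha>\<^sup>-\<^sup>1 M\<^sup>-\<^sup>1)\<close> in order zero.
\<close>

definition unknot_lead :: laurent3 where
  "unknot_lead = Poly_Mapping.single (1, 0, 1) 1 - Poly_Mapping.single (- 1, 0, - 1) 1"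

definition unknot_tail :: "int \<Rightarrow> laurent3" where
  "unknot_tail \<tau> = Poly_Mapping.single (2 * \<tau>, 0, 0) ((- 1) powi \<tau>) *
     (Poly_Mapping.single (1, 1, 0) 1 - Poly_Mapping.single (- 1, - 1, 0) 1)"

definition unknot_recursion :: "int \<Rightarrow> laurent3 poly" where
  "unknot_recursion \<tau> = [: - unknot_tail \<tau>, unknot_lead :]"

lemma laurent3_eval_unknot_lead:
  "laurent3_eval unknot_lead (qh ^ n) ah qh = qh ^ Suc n - inverse (qh ^ Suc n)"
  by (simp add: unknot_lead_def laurent3_eval_diff laurent3_eval_single power_int_minus mult.commute)

lemma laurent3_eval_unknot_tail:
  "laurent3_eval (unknot_tail \<tau>) (qh ^ n) ah qh =
     (- 1) powi \<tau> * qh powi (2 * int n * \<tau>) * (ah * qh ^ n - inverse ah * inverse (qh ^ n))"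
proof -
  have "of_rat ((- 1) powi \<tau>) = ((- 1) powi \<tau> :: ratfun)"
    by (auto simp: power_int_minus_left of_rat_minus)
  then show ?thesis
    by (simp add: unknot_tail_def laurent3_eval_mult laurent3_eval_diff laurent3_eval_single
          power_int_minus mult_ac flip: power_int_of_nat power_int_mult)
qed

lemma qh_power_neq_inverse: "qh ^ Suc n - inverse (qh ^ Suc n) \<noteq> 0"
proof
  assume "qh ^ Suc n - inverse (qh ^ Suc n) = 0"
  then have "qh ^ Suc n = inverse (qh ^ Suc n)" by (simp only: right_minus_eq)
  then have "ah powi 0 * qh powi int (Suc n) = ah powi 0 * qh powi (- int (Suc n))"
    by (simp only: power_int_minus power_int_of_nat)
  from ah_qh_monomial_eqD[OF this] show False by simp
qed

lemma ah_qh_power_neq_inverse: "ah * qh ^ n - inverse ah * inverse (qh ^ n) \<noteq> 0"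
  using ah_qh_monomial_eqD[of 1 "int n" "- 1" "- int n"]
  by (auto simp: power_int_minus)

lemma framed_homfly_unknot_Suc:
  "laurent3_eval unknot_lead (qh ^ n) ah qh * framed_homfly_unknot \<tau> (Suc n) =
     laurent3_eval (unknot_tail \<tau>) (qh ^ n) ah qh * framed_homfly_unknot \<tau> n"
proof -
  have "homfly_unknot (Suc n) = homfly_unknot n *
      ((ah * qh ^ n - inverse ah * inverse (qh ^ n)) / (qh ^ Suc n - inverse (qh ^ Suc n)))"
    by (simp add: homfly_unknot_def)
  then have 1: "(qh ^ Suc n - inverse (qh ^ Suc n)) * homfly_unknot (Suc n) =
      (ah * qh ^ n - inverse ah * inverse (qh ^ n)) * homfly_unknot n"
    using qh_power_neq_inverse[of n] by simp
  have 2: "(- 1) powi (int (Suc n) * \<tau>) = (- 1) powi \<tau> * (- 1 :: ratfun) powi (int n * \<tau>)"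
    by (simp add: algebra_simps flip: power_int_add)
  have "int (Suc n) * (int (Suc n) - 1) * \<tau> = 2 * int n * \<tau> + int n * (int n - 1) * \<tau>"
    by (simp add: algebra_simps)
  then have 3: "qh powi (int (Suc n) * (int (Suc n) - 1) * \<tau>) =
      qh powi (2 * int n * \<tau>) * qh powi (int n * (int n - 1) * \<tau>)"
    by (simp only: power_int_add[OF disjI1[OF qh_nonzero]])
  show ?thesis
    unfolding framed_homfly_unknot_def laurent3_eval_unknot_lead laurent3_eval_unknot_tail 2 3
    using 1 by (metis (no_types, lifting) mult.assoc mult.left_commute)
qed

lemma homfly_unknot_nonzero: "homfly_unknot n \<noteq> 0"
proof -
  have "(ah * qh ^ (k - 1) - inverse ah * inverse (qh ^ (k - 1))) / (qh ^ k - inverse (qh ^ k)) \<noteq> 0"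
    if "k \<in> {1..n}" for k
    using that qh_power_neq_inverse[of "k - 1"] ah_qh_power_neq_inverse[of "k - 1"] by simp
  then show ?thesis by (simp add: homfly_unknot_def)
qed

lemma framed_homfly_unknot_nonzero: "framed_homfly_unknot \<tau> n \<noteq> 0"
  by (simp add: framed_homfly_unknot_def homfly_unknot_nonzero)

text \<open>
  The two coefficients are coprime: up to a monomial the second one is \<open>1 - \<alpha>\<^sup>2 M\<^sup>2\<close>, whereas the first
  one does not involve \<open>\<alpha>\<close>.
\<close>

lemma unknot_lead_dvd_cancel:
  assumes "unknot_lead dvd b * unknot_tail \<tau>"
  shows "unknot_lead dvd b"
proof -
  define s :: laurent3 where "s = Poly_Mapping.single (1 - 2 * \<tau>, 1, 0) (- ((- 1) powi \<tau>))"
  have "s * unknot_tail \<tau> = 1 - Poly_Mapping.single (2, 2, 0) 1"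
    by (simp add: s_def unknot_tail_def right_diff_distrib mult_single single_uminus
          flip: single_one zero_prod_def)
  then have "(1 - Poly_Mapping.single (2, 2, 0) 1) * b = s * unknot_tail \<tau> * b" by simp
  also have "\<dots> = s * (b * unknot_tail \<tau>)" by (simp only: mult_ac)
  finally have "unknot_lead dvd (1 - Poly_Mapping.single (2, 2, 0) 1) * b"
    by (simp only: dvd_mult[OF assms])
  moreover have "j = 0" if "(i, j, k) \<in> Poly_Mapping.keys unknot_lead" for i j k
    using that by (auto simp: unknot_lead_def in_keys_iff lookup_minus lookup_single when_def split: if_splits)
  ultimately show ?thesis
    by (intro dvd_if_dvd_one_minus_monomial_mult[of unknot_lead 2 2 0 b]) simp_all
qed

lemma unknot_lead_nonzero: "unknot_lead \<noteq> 0"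
proof -
  have "Poly_Mapping.lookup unknot_lead (1, 0, 1) = 1"
    by (simp add: unknot_lead_def lookup_minus lookup_single)
  then show ?thesis by auto
qed

lemma degree_unknot_recursion: "degree (unknot_recursion \<tau>) = 1"
  by (simp add: unknot_recursion_def unknot_lead_nonzero)

lemma op_apply_degree_1:
  "degree A = 1 \<Longrightarrow> op_apply A f n =
     laurent3_eval (coeff A 0) (qh ^ n) ah qh * f n + laurent3_eval (coeff A 1) (qh ^ n) ah qh * f (Suc n)"
  by (simp add: op_apply_def)

lemma annihilates_unknot_recursion: "annihilates (unknot_recursion \<tau>) (framed_homfly_unknot \<tau>)"
proof -
  have "op_apply (unknot_recursion \<tau>) (framed_homfly_unknot \<tau>) n = 0" for n
    using framed_homfly_unknot_Suc[of n \<tau>] unfolding op_apply_degree_1[OF degree_unknot_recursion]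
    by (simp add: unknot_recursion_def laurent3_eval_uminus)
  then show ?thesis by (simp add: annihilates_def)
qed

lemma infinite_zeros_if_annihilates:
  "annihilates B f \<Longrightarrow> infinite {n. op_apply B f n = 0}"
  unfolding annihilates_def
proof
  assume "finite {n. op_apply B f n \<noteq> 0}" "finite {n. op_apply B f n = 0}"
  then have "finite ({n. op_apply B f n \<noteq> 0} \<union> {n. op_apply B f n = 0})" by (rule finite_UnI)
  moreover have "{n. op_apply B f n \<noteq> 0} \<union> {n. op_apply B f n = 0} = UNIV" by auto
  ultimately show False by simp
qed

lemma annihilator_degree_pos:
  assumes "B \<noteq> 0" "annihilates B (framed_homfly_unknot \<tau>)"
  shows "degree B \<ge> 1"
proof (rule ccontr)
  assume "\<not> degree B \<ge> 1"
  then have deg: "degree B = 0" by simp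
  have "{n. op_apply B (framed_homfly_unknot \<tau>) n = 0} = {n. laurent3_eval (coeff B 0) (qh ^ n) ah qh = 0}"
    by (simp add: op_apply_def deg framed_homfly_unknot_nonzero)
  then have "coeff B 0 = 0"
    using infinite_zeros_if_annihilates[OF assms(2)] laurent3_eq_0_if_eval_eq_0 by metis
  then show False using deg assms(1) by (metis leading_coeff_0_iff)
qed

text \<open>
  Eliminating \<open>H\<^sub>n\<^sub>+\<^sub>1\<close> with the explicit relation turns the annihilation into a polynomial identity
  between the coefficients; coprimality then produces the common multiplier \<open>h\<close>.
\<close>

lemma first_order_annihilator:
  assumes deg: "degree A = 1" and ann: "annihilates A (framed_homfly_unknot \<tau>)"
  shows "\<exists>h. coeff A 0 = - (h * unknot_tail \<tau>) \<and> coeff A 1 = h * unknot_lead"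
proof -
  let ?f = "framed_homfly_unknot \<tau>" and ?e = "\<lambda>p n. laurent3_eval p (qh ^ n) ah qh"
  let ?D = "coeff A 0 * unknot_lead + coeff A 1 * unknot_tail \<tau>"
  have "?e ?D n = 0" if "op_apply A ?f n = 0" for n
  proof -
    have "?e ?D n * ?f n = ?e unknot_lead n * (?e (coeff A 0) n * ?f n) + ?e (coeff A 1) n * (?e (unknot_tail \<tau>) n * ?f n)"
      by (simp add: laurent3_eval_add laurent3_eval_mult algebra_simps)
    also have "\<dots> = ?e unknot_lead n * (?e (coeff A 0) n * ?f n) + ?e (coeff A 1) n * (?e unknot_lead n * ?f (Suc n))"
      by (simp only: framed_homfly_unknot_Suc)
    also have "\<dots> = ?e unknot_lead n * op_apply A ?f n"
      unfolding op_apply_degree_1[OF deg] by (simp add: algebra_simps)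
    finally show ?thesis using that by (simp add: framed_homfly_unknot_nonzero)
  qed
  then have "infinite {n. ?e ?D n = 0}"
    using infinite_zeros_if_annihilates[OF ann] by (metis (mono_tags, lifting) mem_Collect_eq rev_finite_subset subsetI)
  then have D: "?D = 0" by (rule laurent3_eq_0_if_eval_eq_0)
  then have "coeff A 1 * unknot_tail \<tau> = unknot_lead * (- coeff A 0)"
    by (simp add: add_eq_0_iff mult.commute)
  then have "unknot_lead dvd coeff A 1 * unknot_tail \<tau>" by (rule dvdI)
  then have "unknot_lead dvd coeff A 1" by (rule unknot_lead_dvd_cancel)
  then obtain h where h: "coeff A 1 = unknot_lead * h" ..
  have "unknot_lead * (coeff A 0 + h * unknot_tail \<tau>) = 0"
    using D unfolding h by (simp only: distrib_left mult_ac)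
  then have "coeff A 0 + h * unknot_tail \<tau> = 0"
    using unknot_lead_nonzero by (simp only: mult_eq_0_iff simp_thms)
  then have "coeff A 0 = - (h * unknot_tail \<tau>)" by (rule eq_neg_iff_add_eq_0[THEN iffD2])
  moreover have "coeff A 1 = h * unknot_lead" unfolding h by (rule mult.commute)
  ultimately show ?thesis by blast
qed

lemma coprime_unknot_recursion:
  assumes "g dvd unknot_lead" "g dvd unknot_tail \<tau>"
  shows "g dvd 1"
proof -
  obtain k k' where k: "unknot_lead = g * k" "unknot_tail \<tau> = g * k'" using assms by (auto elim!: dvdE)
  then have "k * unknot_tail \<tau> = unknot_lead * k'" by (simp add: mult_ac)
  then have "unknot_lead dvd k * unknot_tail \<tau>" by (rule dvdI)
  then have "unknot_lead dvd k" by (rule unknot_lead_dvd_cancel)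
  then obtain h where "k = unknot_lead * h" ..
  then have "unknot_lead = unknot_lead * (g * h)" using k(1) by (simp only: mult_ac)
  then have "1 = g * h" using unknot_lead_nonzero by simp
  then show ?thesis by (rule dvdI)
qed

lemma minimal_unknot_recursion: "is_minimal_recursion (framed_homfly_unknot \<tau>) (unknot_recursion \<tau>)"
  unfolding is_minimal_recursion_def
proof (intro conjI allI impI)
  show "unknot_recursion \<tau> \<noteq> 0" using degree_unknot_recursion[of \<tau>] by auto
  show "annihilates (unknot_recursion \<tau>) (framed_homfly_unknot \<tau>)" by (rule annihilates_unknot_recursion)
  show "degree (unknot_recursion \<tau>) \<le> degree B" if "B \<noteq> 0" "annihilates B (framed_homfly_unknot \<tau>)" for B
    using annihilator_degree_pos[OF that] by (simp add: degree_unknot_recursion)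
  fix g assume g: "\<forall>l. g dvd coeff (unknot_recursion \<tau>) l"
  show "g dvd 1"
    using g[rule_format, of 0] g[rule_format, of 1]
    by (intro coprime_unknot_recursion[of g \<tau>]) (simp_all add: unknot_recursion_def)
qed

text \<open>
  The multiplier relating a minimal operator to the explicit one divides all coefficients, so it is a
  unit and hence a monomial.
\<close>

lemma minimal_recursion_unique:
  assumes "is_minimal_recursion (framed_homfly_unknot \<tau>) A"
  shows "\<exists>e c. c \<noteq> 0 \<and> degree A = 1 \<and> coeff A 0 = - (Poly_Mapping.single e c * unknot_tail \<tau>) \<and>
           coeff A 1 = Poly_Mapping.single e c * unknot_lead"
proof -
  have A: "A \<noteq> 0" "annihilates A (framed_homfly_unknot \<tau>)"
    "\<And>B. B \<noteq> 0 \<Longrightarrow> annihilates B (framed_homfly_unknot \<tau>) \<Longrightarrow> degree A \<le> degree B"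
    and unit: "\<And>g. (\<And>l. g dvd coeff A l) \<Longrightarrow> g dvd 1"
    using assms unfolding is_minimal_recursion_def by blast+
  have "unknot_recursion \<tau> \<noteq> 0" using degree_unknot_recursion[of \<tau>] by auto
  then have "degree A \<le> 1"
    using A(3) annihilates_unknot_recursion degree_unknot_recursion by metis
  then have deg: "degree A = 1" using annihilator_degree_pos[OF A(1,2)] by simp
  then obtain h where h: "coeff A 0 = - (h * unknot_tail \<tau>)" "coeff A 1 = h * unknot_lead"
    using first_order_annihilator[OF _ A(2)] by blast
  have "h dvd coeff A l" for l
  proof -
    consider "l = 0" | "l = 1" | "l > degree A" using deg by linarith
    then show ?thesis by cases (simp_all add: h h[unfolded One_nat_def] coeff_eq_0)
  qed
  then obtain h' where "h * h' = 1" using unit[of h] by (auto elim!: dvdE)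
  from laurent_unit_is_monomial[OF this] show ?thesis using h deg by blast
qed

lemma laurent_at_q1_add: "laurent_at_q1 (p + p') = laurent_at_q1 p + laurent_at_q1 p'"
  unfolding laurent_at_q1_def case_prod_unfold prod.collapse
  by (rule setsum_keys_plus_distrib) (simp_all add: single_add)

lemma laurent_at_q1_0 [simp]: "laurent_at_q1 0 = 0"
  by (simp add: laurent_at_q1_def)

lemma laurent_at_q1_single:
  "laurent_at_q1 (Poly_Mapping.single (i, j, k) c) = Poly_Mapping.single (i, j) c"
  by (simp add: laurent_at_q1_def)

lemma laurent_at_q1_diff: "laurent_at_q1 (p - p') = laurent_at_q1 p - laurent_at_q1 p'"
  using laurent_at_q1_add[of "p - p'" p'] by simp

text \<open>
  The contribution of the coefficient of \<open>L\<^sup>l\<close> to the dual substitution.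
\<close>

definition dual_term :: "nat \<Rightarrow> laurent2 \<Rightarrow> laurent3" where
  "dual_term l p = (\<Sum>(i, j)\<in>Poly_Mapping.keys p. Poly_Mapping.single (- int l, i, j) (Poly_Mapping.lookup p (i, j)))"

lemma dual_term_add: "dual_term l (p + p') = dual_term l p + dual_term l p'"
  unfolding dual_term_def case_prod_unfold prod.collapse
  by (rule setsum_keys_plus_distrib) (simp_all add: single_add)

lemma dual_term_single: "dual_term l (Poly_Mapping.single (i, j) c) = Poly_Mapping.single (- int l, i, j) c"
  by (simp add: dual_term_def)

lemma dual_term_diff: "dual_term l (p - p') = dual_term l p - dual_term l p'"
  using dual_term_add[of l "p - p'" p'] by simp

lemma dual_substitution_classical_limit:
  assumes deg: "degree A = 1" and ne: "laurent_at_q1 (coeff A 1) \<noteq> 0"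
  shows "dual_substitution (classical_limit A) =
           dual_term 0 (laurent_at_q1 (coeff A 0)) + dual_term 1 (laurent_at_q1 (coeff A 1))"
proof -
  have "degree (classical_limit A) = 1"
    unfolding classical_limit_def using ne
    by (intro antisym degree_le le_degree) (simp_all add: coeff_map_poly coeff_eq_0 deg)
  then show ?thesis
    by (simp add: dual_substitution_def deg classical_limit_def coeff_map_poly dual_term_def)
qed

theorem dual_A_polynomial_unknot:
  "(\<exists>P. is_dual_A_polynomial (framed_homfly_unknot \<tau>) P) \<and>
   (\<forall>P. is_dual_A_polynomial (framed_homfly_unknot \<tau>) P \<longrightarrow> eq_up_to_monomial P (unknot_dual_A \<tau>))"
proof (intro conjI allI impI)
  show "\<exists>P. is_dual_A_polynomial (framed_homfly_unknot \<tau>) P"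
    using minimal_unknot_recursion unfolding is_dual_A_polynomial_def by blast
next
  fix P assume "is_dual_A_polynomial (framed_homfly_unknot \<tau>) P"
  then obtain A where A: "is_minimal_recursion (framed_homfly_unknot \<tau>) A"
    and P: "P = dual_substitution (classical_limit A)"
    unfolding is_dual_A_polynomial_def by blast
  obtain e c where c: "c \<noteq> 0" and deg: "degree A = 1"
    and A0: "coeff A 0 = - (Poly_Mapping.single e c * unknot_tail \<tau>)"
    and A1: "coeff A 1 = Poly_Mapping.single e c * unknot_lead"
    using minimal_recursion_unique[OF A] by blast
  obtain i j k where e: "e = (i, j, k)" by (cases e)
  define s :: rat where "s = (- 1) powi \<tau>"
  have s: "s * s = 1" by (simp add: s_def flip: power_int_mult_distrib)
  have A0': "coeff A 0 = Poly_Mapping.single (i + 2 * \<tau> - 1, j - 1, k) (c * s) - Poly_Mapping.single (i + 2 * \<tau> + 1, j + 1, k) (c * s)"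
    by (simp add: A0 unknot_tail_def right_diff_distrib mult_single e s_def algebra_simps)
  have A1': "coeff A 1 = Poly_Mapping.single (i + 1, j, k + 1) c - Poly_Mapping.single (i - 1, j, k - 1) c"
    by (simp add: A1[unfolded One_nat_def] unknot_lead_def right_diff_distrib mult_single e)
  have lim1: "laurent_at_q1 (coeff A 1) = Poly_Mapping.single (i + 1, j) c - Poly_Mapping.single (i - 1, j) c"
    unfolding A1' by (simp add: laurent_at_q1_diff laurent_at_q1_single)
  have "Poly_Mapping.lookup (laurent_at_q1 (coeff A 1)) (i + 1, j) = c"
    unfolding lim1 by (simp add: lookup_minus lookup_single)
  then have ne: "laurent_at_q1 (coeff A 1) \<noteq> 0" using c by auto
  have P': "P = Poly_Mapping.single (0, i + 2 * \<tau> - 1, j - 1) (c * s) - Poly_Mapping.single (0, i + 2 * \<tau> + 1, j + 1) (c * s)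
      + (Poly_Mapping.single (- 1, i + 1, j) c - Poly_Mapping.single (- 1, i - 1, j) c)"
    unfolding P dual_substitution_classical_limit[OF deg ne] lim1 A0'
    by (simp add: laurent_at_q1_diff laurent_at_q1_single dual_term_diff dual_term_single)
  have Q: "unknot_dual_A \<tau> = Poly_Mapping.single (0, 2, 0) s - Poly_Mapping.single (0, 0, 0) s
      - (Poly_Mapping.single (1, 2 + 2 * \<tau>, 1) 1 - Poly_Mapping.single (1, 2 * \<tau>, - 1) 1)"
    by (simp add: unknot_dual_A_def mon_def mult_single right_diff_distrib left_diff_distrib zero_prod_def s_def)
  have "P = Poly_Mapping.single (- 1, i - 1, j) (c * s) * unknot_dual_A \<tau>"
    using s unfolding P' Q by (simp add: right_diff_distrib mult_single mult.assoc algebra_simps)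
  moreover have "c * s \<noteq> 0" using c by (simp add: s_def)
  ultimately show "eq_up_to_monomial P (unknot_dual_A \<tau>)"
    unfolding eq_up_to_monomial_def by blast
qed

section \<open>Lagrange inversion for exponentials of power series\<close>

definition fps_Exp :: "'a::field_char_0 fps \<Rightarrow> 'a fps" where
  "fps_Exp g = fps_compose (fps_exp 1) g"

lemma fps_Exp_nth_0 [simp]: "fps_Exp g $ 0 = 1"
  by (simp add: fps_Exp_def)

lemma fps_deriv_Exp: "g $ 0 = 0 \<Longrightarrow> fps_deriv (fps_Exp g) = fps_deriv g * fps_Exp g"
  by (simp add: fps_Exp_def fps_compose_deriv mult.commute)

lemma fps_linear_ode_unique:
  fixes f f' g :: "'a::field_char_0 fps"
  assumes "fps_deriv f = g * f" "fps_deriv f' = g * f'" "f $ 0 = f' $ 0"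
  shows "f = f'"
proof (rule fps_ext)
  fix n show "f $ n = f' $ n"
  proof (induction n rule: less_induct)
    case (less n)
    show ?case
    proof (cases n)
      case (Suc m)
      have "of_nat (Suc m) * f $ Suc m = (g * f) $ m" "of_nat (Suc m) * f' $ Suc m = (g * f') $ m"
        using assms(1,2) by (metis fps_deriv_nth Suc_eq_plus1)+
      moreover have "(g * f) $ m = (g * f') $ m"
        unfolding fps_mult_nth using less Suc by (intro sum.cong refl arg_cong2[where f = "(*)"]) auto
      ultimately have "of_nat (Suc m) * f $ Suc m = of_nat (Suc m) * f' $ Suc m" by simp
      then show ?thesis using Suc by (simp del: of_nat_Suc)
    qed (use assms(3) in simp)
  qed
qed

lemma fps_Exp_0 [simp]: "fps_Exp 0 = 1"
  by (rule fps_linear_ode_unique[of _ 0]) (simp_all add: fps_deriv_Exp)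

lemma fps_Exp_add:
  assumes "g $ 0 = 0" "h $ 0 = 0"
  shows "fps_Exp (g + h) = fps_Exp g * fps_Exp h"
  by (rule fps_linear_ode_unique[of _ "fps_deriv g + fps_deriv h"])
     (simp_all add: fps_deriv_Exp assms algebra_simps)

text \<open>
  The integer powers of \<open>fps_Exp g\<close>; negative ones are needed, since the framing may be negative.
\<close>

definition fps_Exp_multiple :: "'a::field_char_0 fps \<Rightarrow> int \<Rightarrow> 'a fps" where
  "fps_Exp_multiple g p = fps_Exp (fps_const (of_int p) * g)"

lemma fps_Exp_multiple_add:
  "g $ 0 = 0 \<Longrightarrow> fps_Exp_multiple g (p + p') = fps_Exp_multiple g p * fps_Exp_multiple g p'"
  unfolding fps_Exp_multiple_def
  by (subst fps_Exp_add[symmetric]) (simp_all flip: fps_const_add distrib_right)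

lemma fps_Exp_multiple_0 [simp]: "fps_Exp_multiple g 0 = 1"
  by (simp add: fps_Exp_multiple_def)

lemma fps_Exp_multiple_1: "fps_Exp_multiple g 1 = fps_Exp g"
  by (simp add: fps_Exp_multiple_def)

lemma fps_Exp_multiple_power:
  "g $ 0 = 0 \<Longrightarrow> fps_Exp_multiple g p ^ n = fps_Exp_multiple g (int n * p)"
  by (induction n) (simp_all add: distrib_right fps_Exp_multiple_add)

text \<open>
  With \<open>W = fps_Exp g - 1\<close> the left-hand side is the residue of \<open>W\<^bsup>-k-1\<^esup> (1 + W)\<^sup>p dW\<close>, which a change of
  variables would identify with the coefficient of \<open>W\<^sup>k\<close> in \<open>(1 + W)\<^sup>p\<close>. Instead of composing series
  the proof lets \<open>p\<close> vary: since \<open>(1 + W)\<^bsup>p+1\<^esup> = (1 + W)\<^sup>p + W (1 + W)\<^sup>p\<close>, the residues obey Pascal's rule,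
  which determines them for all integers \<open>p\<close> from the case \<open>p = 0\<close>, where the form is exact unless \<open>k = 0\<close>.
\<close>

lemma exponential_residue:
  fixes g \<Phi> :: "'a::field_char_0 fps" and p :: int
  assumes g0: "g $ 0 = 0" and \<Phi>0: "\<Phi> $ 0 \<noteq> 0" and W: "fps_Exp g = 1 + fps_X * \<Phi>"
  shows "(inverse \<Phi> ^ Suc k * fps_Exp_multiple g p * fps_deriv (fps_Exp g)) $ k = of_int p gchoose k"
proof -
  define \<Psi> where "\<Psi> = inverse \<Phi>"
  have \<Psi>\<Phi>: "\<Psi> * \<Phi> = 1" unfolding \<Psi>_def using \<Phi>0 by (rule inverse_mult_eq_1)
  define A where "A k p = (\<Psi> ^ Suc k * fps_Exp_multiple g p * fps_deriv (fps_Exp g)) $ k" for k p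
  \<comment> \<open>Pascal's rule before taking coefficients.\<close>
  have step: "\<Psi> ^ Suc k * fps_Exp_multiple g (p + 1) * fps_deriv (fps_Exp g) =
      \<Psi> ^ Suc k * fps_Exp_multiple g p * fps_deriv (fps_Exp g) +
      fps_X * (\<Psi> ^ k * fps_Exp_multiple g p * fps_deriv (fps_Exp g))" for k p
  proof -
    have "\<Psi> ^ Suc k * fps_Exp_multiple g (p + 1) = \<Psi> ^ Suc k * fps_Exp_multiple g p * (1 + fps_X * \<Phi>)"
      using g0 by (simp only: fps_Exp_multiple_add fps_Exp_multiple_1 W mult.assoc)
    also have "\<dots> = \<Psi> ^ Suc k * fps_Exp_multiple g p + fps_X * (\<Psi> ^ k * fps_Exp_multiple g p) * (\<Psi> * \<Phi>)"
      by (simp add: algebra_simps)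
    finally show ?thesis unfolding \<Psi>\<Phi> by (simp only: mult_1_right distrib_right mult.assoc)
  qed
  have A0: "A 0 (p + 1) = A 0 p" for p
    unfolding A_def step[of 0 p] by simp
  have ASuc: "A (Suc k) (p + 1) = A (Suc k) p + A k p" for k p
    unfolding A_def step[of "Suc k" p] by simp
  have deriv: "fps_deriv (fps_Exp g) = \<Phi> + fps_X * fps_deriv \<Phi>"
    unfolding W by (simp add: algebra_simps)
  have base: "A k 0 = 0 gchoose k" for k
  proof (cases k)
    case 0
    then show ?thesis using \<Phi>0 by (simp add: A_def deriv \<Psi>_def)
  next
    case (Suc j)
    have "fps_deriv \<Psi> = - fps_deriv \<Phi> * \<Psi>\<^sup>2"
      unfolding \<Psi>_def by (rule fps_inverse_deriv) (rule \<Phi>0)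
    then have d: "fps_deriv (\<Psi> ^ k) = - (fps_const (of_nat k) * (\<Psi> ^ Suc k * fps_deriv \<Phi>))"
      unfolding fps_deriv_power by (simp add: Suc power2_eq_square mult_ac)
    have "\<Psi> ^ Suc k * fps_deriv (fps_Exp g) = \<Psi> ^ k * (\<Psi> * \<Phi>) + fps_X * (\<Psi> ^ Suc k * fps_deriv \<Phi>)"
      unfolding deriv by (simp add: algebra_simps)
    then have "A k 0 = (\<Psi> ^ k) $ k + (\<Psi> ^ Suc k * fps_deriv \<Phi>) $ j"
      by (simp add: A_def \<Psi>\<Phi> Suc)
    moreover have "of_nat k * (\<Psi> ^ k) $ k = - (of_nat k * (\<Psi> ^ Suc k * fps_deriv \<Phi>) $ j)"
      using arg_cong[OF d, of "\<lambda>f. f $ j"] by (simp add: Suc del: of_nat_Suc power_Suc)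
    then have "of_nat k * ((\<Psi> ^ k) $ k + (\<Psi> ^ Suc k * fps_deriv \<Phi>) $ j) = 0"
      by (simp add: distrib_left)
    then have "(\<Psi> ^ k) $ k + (\<Psi> ^ Suc k * fps_deriv \<Phi>) $ j = 0"
      using Suc by (simp del: of_nat_Suc)
    ultimately show ?thesis by (simp add: Suc)
  qed
  have "A k p = of_int p gchoose k" for k p
  proof (induction k arbitrary: p)
    case 0
    show ?case
    proof (induction p rule: int_induct[where k = 0])
      case (step2 i)
      then show ?case using A0[of "i - 1"] by simp
    qed (simp_all add: base A0)
  next
    case (Suc k)
    have pascal: "of_int (p + 1) gchoose Suc k = (of_int p gchoose k) + (of_int p gchoose Suc k :: 'a)" for p
      using gbinomial_Suc_Suc[of "of_int p :: 'a" k] by simp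
    show ?case
    proof (induction p rule: int_induct[where k = 0])
      case base
      show ?case using \<open>\<And>k. A k 0 = 0 gchoose k\<close> by simp
    next
      case (step1 i)
      then show ?case unfolding ASuc pascal Suc.IH by simp
    next
      case (step2 i)
      then show ?case using ASuc[of k "i - 1"] pascal[of "i - 1"] Suc.IH[of "i - 1"] by simp
    qed
  qed
  then show ?thesis unfolding A_def \<Psi>_def by blast
qed

text \<open>
  Lagrange inversion for \<open>Y - 1 = x \<sigma> (\<alpha> Y\<^bsup>t+1\<^esup> - \<beta> Y\<^sup>t)\<close>, with \<open>Y = fps_Exp g\<close>. Writing the equation as
  \<open>Y - 1 = x \<Phi>\<close>, one has \<open>g' = Y\<^sup>-\<^sup>1 Y' = \<Phi>\<^sup>-\<^sup>n \<Phi>\<^sup>n Y\<^sup>-\<^sup>1 Y'\<close>; the binomial expansion of \<open>\<Phi>\<^sup>n\<close> leaves terms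
  \<open>\<Phi>\<^sup>-\<^sup>n Y\<^sup>p Y'\<close>, whose coefficients are the residues computed above.
\<close>

lemma lagrange_two_exponentials:
  fixes g :: "'a::field_char_0 fps" and t :: int
  assumes g0: "g $ 0 = 0" and \<sigma>: "\<sigma> \<noteq> 0" and \<alpha>\<beta>: "\<alpha> \<noteq> \<beta>"
    and eq: "fps_Exp g - 1 = fps_X * (fps_const \<sigma> *
      (fps_const \<alpha> * fps_Exp_multiple g (t + 1) - fps_const \<beta> * fps_Exp_multiple g t))"
    and n: "n \<ge> 1"
  shows "of_nat n * g $ n = \<sigma> ^ n * (\<Sum>i\<le>n. of_nat (n choose i) * \<alpha> ^ i * (- \<beta>) ^ (n - i) *
           (of_int (int n * t + int i - 1) gchoose (n - 1)))"
proof -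
  obtain k where k: "n = Suc k" using n by (cases n) auto
  let ?E = "fps_Exp_multiple g"
  define \<Phi> where "\<Phi> = fps_const \<sigma> * (fps_const \<alpha> * ?E (t + 1) - fps_const \<beta> * ?E t)"
  have W: "fps_Exp g = 1 + fps_X * \<Phi>" using eq by (simp add: \<Phi>_def algebra_simps)
  have "?E p $ 0 = 1" for p by (simp add: fps_Exp_multiple_def)
  then have \<Phi>0: "\<Phi> $ 0 \<noteq> 0" using \<sigma> \<alpha>\<beta> by (simp add: \<Phi>_def)
  have "\<Phi> = fps_const \<sigma> * (fps_const \<alpha> * ?E (t + 1) + fps_const (- \<beta>) * ?E t)"
    by (simp add: \<Phi>_def flip: fps_const_neg)
  then have "\<Phi> ^ n = fps_const (\<sigma> ^ n) * (\<Sum>i\<le>n. of_nat (n choose i) *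
      (fps_const \<alpha> * ?E (t + 1)) ^ i * (fps_const (- \<beta>) * ?E t) ^ (n - i))"
    by (simp only: power_mult_distrib binomial_ring fps_const_power)
  also have "(\<Sum>i\<le>n. of_nat (n choose i) * (fps_const \<alpha> * ?E (t + 1)) ^ i * (fps_const (- \<beta>) * ?E t) ^ (n - i)) =
      (\<Sum>i\<le>n. fps_const (of_nat (n choose i) * \<alpha> ^ i * (- \<beta>) ^ (n - i)) * ?E (int n * t + int i))"
  proof (intro sum.cong refl)
    fix i assume "i \<in> {..n}"
    then have i: "int (n - i) = int n - int i" by simp
    have "int i * (t + 1) + int (n - i) * t = int n * t + int i" unfolding i by (simp add: algebra_simps)
    then have "?E (t + 1) ^ i * ?E t ^ (n - i) = ?E (int n * t + int i)"
      by (simp add: fps_Exp_multiple_power[OF g0] flip: fps_Exp_multiple_add[OF g0])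
    moreover have "of_nat (n choose i) * (fps_const \<alpha> * ?E (t + 1)) ^ i * (fps_const (- \<beta>) * ?E t) ^ (n - i) =
        fps_const (of_nat (n choose i) * \<alpha> ^ i * (- \<beta>) ^ (n - i)) * (?E (t + 1) ^ i * ?E t ^ (n - i))"
      by (simp only: power_mult_distrib fps_const_power fps_of_nat[symmetric] fps_const_mult[symmetric] mult_ac)
    ultimately show "of_nat (n choose i) * (fps_const \<alpha> * ?E (t + 1)) ^ i * (fps_const (- \<beta>) * ?E t) ^ (n - i) =
        fps_const (of_nat (n choose i) * \<alpha> ^ i * (- \<beta>) ^ (n - i)) * ?E (int n * t + int i)" by simp
  qed
  finally have \<Phi>n: "\<Phi> ^ n = fps_const (\<sigma> ^ n) *
      (\<Sum>i\<le>n. fps_const (of_nat (n choose i) * \<alpha> ^ i * (- \<beta>) ^ (n - i)) * ?E (int n * t + int i))" .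
  have E1: "?E (- 1) * fps_Exp g = 1"
    using fps_Exp_multiple_add[OF g0, of "- 1" 1] by (simp add: fps_Exp_multiple_1)
  have "inverse \<Phi> ^ n * \<Phi> ^ n = 1"
    using inverse_mult_eq_1[OF \<Phi>0] by (simp flip: power_mult_distrib)
  then have "fps_deriv g = fps_deriv g * (?E (- 1) * fps_Exp g) * (inverse \<Phi> ^ n * \<Phi> ^ n)"
    by (simp add: E1)
  also have "\<dots> = inverse \<Phi> ^ n * \<Phi> ^ n * ?E (- 1) * fps_deriv (fps_Exp g)"
    by (simp add: fps_deriv_Exp[OF g0] mult_ac)
  also have "\<dots> = fps_const (\<sigma> ^ n) * (\<Sum>i\<le>n. fps_const (of_nat (n choose i) * \<alpha> ^ i * (- \<beta>) ^ (n - i)) *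
      (inverse \<Phi> ^ n * (?E (int n * t + int i) * ?E (- 1)) * fps_deriv (fps_Exp g)))"
    unfolding \<Phi>n by (simp add: sum_distrib_left sum_distrib_right mult_ac)
  also have "\<dots> = fps_const (\<sigma> ^ n) * (\<Sum>i\<le>n. fps_const (of_nat (n choose i) * \<alpha> ^ i * (- \<beta>) ^ (n - i)) *
      (inverse \<Phi> ^ n * ?E (int n * t + int i - 1) * fps_deriv (fps_Exp g)))"
    by (simp flip: fps_Exp_multiple_add[OF g0])
  finally have "fps_deriv g $ k = \<sigma> ^ n * (\<Sum>i\<le>n. of_nat (n choose i) * \<alpha> ^ i * (- \<beta>) ^ (n - i) *
      (of_int (int n * t + int i - 1) gchoose k))"
    using exponential_residue[OF g0 \<Phi>0 W, of k] by (simp add: fps_sum_nth k del: power_Suc of_nat_Suc)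
  then show ?thesis by (simp add: k del: power_Suc of_nat_Suc)
qed

section \<open>Moebius inversion\<close>

lemma moebius_mult_prime:
  assumes "prime p" "\<not> p dvd d" "d > 0"
  shows "moebius (p * d) = - moebius d"
proof -
  have cop: "coprime p d" using assms by (simp add: prime_imp_coprime)
  have sqf: "squarefree (p * d) \<longleftrightarrow> squarefree d"
    using squarefree_multD(2)[of p d] squarefree_mult_coprime[OF cop] squarefree_prime[OF assms(1)] by blast
  have "prime_factors (p * d) = insert p (prime_factors d)"
    using assms by (subst prime_factors_product) (auto simp: prime_prime_factors)
  moreover have "p \<notin> prime_factors d" using assms by (auto simp: in_prime_factors_iff)
  ultimately show ?thesis by (simp add: moebius_def sqf)
qed

text \<open>
  For a prime \<open>p\<close> dividing \<open>n\<close>, only the divisors \<open>d\<close> not divisible by \<open>p\<close> and their multiples \<open>p d\<close>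
  contribute, and the two kinds cancel.
\<close>

lemma sum_moebius_divisors:
  assumes "n \<ge> 1"
  shows "(\<Sum>d | d dvd n. moebius d) = (if n = 1 then 1 else 0)"
proof (cases "n = 1")
  case True
  then show ?thesis by (simp add: moebius_def)
next
  case False
  then obtain p where p: "prime p" "p dvd n" using prime_factor_nat by blast
  let ?A = "{d. d dvd n \<and> \<not> p dvd d \<and> p * d dvd n}"
  have fin: "finite {d. d dvd n}" using assms by simp
  have pos: "p > 0" using p by (simp add: prime_gt_0_nat)
  have "(\<Sum>d | d dvd n. moebius d) = (\<Sum>d\<in>?A \<union> (*) p ` ?A. moebius d)"
  proof (rule sum.mono_neutral_right[OF fin])
    show "?A \<union> (*) p ` ?A \<subseteq> {d. d dvd n}" by auto
    show "\<forall>d\<in>{d. d dvd n} - (?A \<union> (*) p ` ?A). moebius d = 0"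
    proof
      fix d assume d: "d \<in> {d. d dvd n} - (?A \<union> (*) p ` ?A)"
      have "p dvd d"
      proof (rule ccontr)
        assume "\<not> p dvd d"
        moreover from this have "p * d dvd n"
          using d p prime_imp_coprime divides_mult by blast
        ultimately show False using d by auto
      qed
      then obtain e where e: "d = p * e" ..
      have "p dvd e"
      proof (rule ccontr)
        assume "\<not> p dvd e"
        then have "e \<in> ?A" using d e dvd_mult_right by auto
        then show False using d e by blast
      qed
      then have "p ^ 2 dvd d" by (auto simp: e power2_eq_square)
      then have "\<not> squarefree d" using p by (intro not_squarefreeI[of p]) auto
      then show "moebius d = 0" by (simp add: moebius_def)
    qed
  qed
  also have "\<dots> = (\<Sum>d\<in>?A. moebius d) + (\<Sum>d\<in>(*) p ` ?A. moebius d)"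
    using fin by (intro sum.union_disjoint) (auto intro: finite_subset[OF _ fin])
  also have "(\<Sum>d\<in>(*) p ` ?A. moebius d) = (\<Sum>d\<in>?A. moebius (p * d))"
    using pos by (subst sum.reindex) (auto simp: inj_on_def)
  also have "\<dots> = - (\<Sum>d\<in>?A. moebius d)"
    unfolding sum_negf[symmetric] using assms p
    by (intro sum.cong refl moebius_mult_prime) (auto intro: dvd_pos_nat)
  finally show ?thesis using False by simp
qed

text \<open>
  Inserting the hypothesis gives a double sum over \<open>d\<close> and \<open>e\<close>. Collecting the terms with the same
  product \<open>t = d e\<close> leaves the sum of \<open>moebius\<close> over the divisors of \<open>t\<close>, which vanishes unless \<open>t = 1\<close>.
\<close>

lemma moebius_inversion_pairs:
  fixes b c :: "nat \<Rightarrow> int \<Rightarrow> 'a::comm_ring_1"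
  assumes c: "\<And>n m. n \<ge> 1 \<Longrightarrow> c n m = (\<Sum>d | d dvd n \<and> int d dvd m. b (n div d) (m div int d))"
    and r: "r \<ge> 1"
  shows "b r m = (\<Sum>d | d dvd r \<and> int d dvd m. of_int (moebius d) * c (r div d) (m div int d))"
proof -
  define D where "D n m = {d. d dvd n \<and> int d dvd m}" for n :: nat and m
  have fin: "finite (D n m)" if "n \<ge> 1" for n m
    unfolding D_def using that by (intro finite_subset[OF _ finite_divisors_nat[of n]]) auto
  have pos: "d \<ge> 1" "r div d \<ge> 1" if "d dvd r" for d
    using that r by (auto simp: Suc_le_eq dvd_div_eq_0_iff intro!: Nat.gr0I)
  have "(\<Sum>d\<in>D r m. of_int (moebius d) * c (r div d) (m div int d)) =
        (\<Sum>d\<in>D r m. \<Sum>e\<in>D (r div d) (m div int d).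
           of_int (moebius d) * b (r div d div e) (m div int d div int e))"
    using pos by (intro sum.cong refl) (simp add: D_def c sum_distrib_left)
  also have "\<dots> = (\<Sum>(d, e)\<in>(SIGMA d:D r m. D (r div d) (m div int d)).
           of_int (moebius d) * b (r div d div e) (m div int d div int e))"
  proof (rule sum.Sigma[OF fin[OF r]], rule ballI)
    fix d assume "d \<in> D r m"
    then have "d dvd r" by (simp add: D_def)
    from fin[OF pos(2)[OF this]] show "finite (D (r div d) (m div int d))" .
  qed
  also have "\<dots> = (\<Sum>(t, d)\<in>(SIGMA t:D r m. {d. d dvd t}). of_int (moebius d) * b (r div t) (m div int t))"
  proof (rule sum.reindex_bij_witness[where i = "\<lambda>(t, d). (d, t div d)" and j = "\<lambda>(d, e). (d * e, d)"])
    fix x assume "x \<in> (SIGMA d:D r m. D (r div d) (m div int d))"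
    then obtain d e where x: "x = (d, e)" "d dvd r" "int d dvd m" "e dvd r div d" "int e dvd m div int d"
      by (auto simp: D_def)
    have d: "d \<ge> 1" using pos x by blast
    show "(case case x of (d, e) \<Rightarrow> (d * e, d) of (t, d) \<Rightarrow> (d, t div d)) = x"
      using x d by simp
    have "d * e dvd r" using x d by (metis dvd_div_iff_mult mult.commute not_one_le_zero)
    moreover have "int (d * e) dvd m" using x d by (metis dvd_div_iff_mult mult.commute not_one_le_zero of_nat_mult of_nat_eq_0_iff)
    ultimately show "(case x of (d, e) \<Rightarrow> (d * e, d)) \<in> (SIGMA t:D r m. {d. d dvd t})"
      using x by (simp add: D_def)
    show "(case case x of (d, e) \<Rightarrow> (d * e, d) of (t, d) \<Rightarrow> of_int (moebius d) * b (r div t) (m div int t)) =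
        (case x of (d, e) \<Rightarrow> of_int (moebius d) * b (r div d div e) (m div int d div int e))"
      using x by (simp add: div_mult2_eq zdiv_zmult2_eq)
  next
    fix y assume "y \<in> (SIGMA t:D r m. {d. d dvd t})"
    then obtain t d where y: "y = (t, d)" "t dvd r" "int t dvd m" "d dvd t"
      by (auto simp: D_def)
    obtain e where e: "t = d * e" using y(4) ..
    have d: "d \<ge> 1" using pos y dvd_trans by blast
    show "(case case y of (t, d) \<Rightarrow> (d, t div d) of (d, e) \<Rightarrow> (d * e, d)) = y"
      using y by simp
    have "d dvd r" "e dvd r div d" using y d e by (auto simp: dvd_div_iff_mult mult.commute dest: dvd_mult_left)
    moreover have "int d dvd m" "int e dvd m div int d"
      using y d e by (auto simp: dvd_div_iff_mult mult.commute dest: dvd_mult_left)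
    ultimately show "(case y of (t, d) \<Rightarrow> (d, t div d)) \<in> (SIGMA d:D r m. D (r div d) (m div int d))"
      using y d e by (simp add: D_def)
  qed
  also have "\<dots> = (\<Sum>t\<in>D r m. \<Sum>d | d dvd t. of_int (moebius d) * b (r div t) (m div int t))"
  proof (rule sum.Sigma[OF fin[OF r], symmetric], rule ballI)
    fix t assume "t \<in> D r m"
    then have "t dvd r" by (simp add: D_def)
    from pos(1)[OF this] show "finite {d. d dvd t}" by simp
  qed
  also have "\<dots> = (\<Sum>t\<in>D r m. of_int (\<Sum>d | d dvd t. moebius d) * b (r div t) (m div int t))"
    by (simp add: sum_distrib_right)
  also have "\<dots> = (\<Sum>t\<in>D r m. if t = 1 then b r m else 0)"
    using pos by (intro sum.cong refl) (simp add: D_def sum_moebius_divisors)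
  also have "\<dots> = b r m" using fin[OF r] by (simp add: D_def)
  finally show ?thesis by (simp add: D_def)
qed

section \<open>The classical limit of the generating series\<close>

text \<open>
  Coefficientwise limit \<open>q \<rightarrow> 1\<close>. The value at \<open>q = 1\<close> is a rational function of \<open>a\<^sup>1\<^sup>/\<^sup>2\<close>, and it is
  considered inside the original field.
\<close>

definition fps_specialises :: "ratfun fps \<Rightarrow> ratfun fps \<Rightarrow> bool" where
  "fps_specialises A B \<longleftrightarrow> (\<forall>n. specialises ah 1 (A $ n) (B $ n))"

lemma fps_specialises_const: "specialises ah 1 c c' \<Longrightarrow> fps_specialises (fps_const c) (fps_const c')"
  by (simp add: fps_specialises_def specialises_0)

lemma fps_specialises_X: "fps_specialises fps_X fps_X"
  by (simp add: fps_specialises_def fps_X_def specialises_0 specialises_1)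

lemma fps_specialises_diff:
  "fps_specialises A B \<Longrightarrow> fps_specialises A' B' \<Longrightarrow> fps_specialises (A - A') (B - B')"
  by (simp add: fps_specialises_def specialises_diff)

lemma fps_specialises_mult:
  "fps_specialises A B \<Longrightarrow> fps_specialises A' B' \<Longrightarrow> fps_specialises (A * A') (B * B')"
  by (simp add: fps_specialises_def fps_mult_nth specialises_sum specialises_mult)

lemma fps_specialises_power: "fps_specialises A B \<Longrightarrow> fps_specialises (A ^ n) (B ^ n)"
  by (induction n) (simp_all add: fps_specialises_mult fps_specialises_const specialises_1 flip: fps_const_1_eq_1)

lemma fps_specialises_Exp: "fps_specialises A B \<Longrightarrow> fps_specialises (fps_Exp A) (fps_Exp B)"
proof -
  assume AB: "fps_specialises A B"
  have "specialises ah 1 ((A ^ i) $ n) ((B ^ i) $ n)" for i n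
    using fps_specialises_power[OF AB] by (simp add: fps_specialises_def)
  moreover have "specialises ah 1 (1 ^ i / of_nat (fact i)) (1 ^ i / of_nat (fact i))" for i
    by (intro specialises_divide specialises_power specialises_1 specialises_of_nat) simp
  ultimately show ?thesis
    unfolding fps_specialises_def fps_Exp_def fps_compose_nth fps_exp_nth
    by (intro allI specialises_sum specialises_mult)
qed

lemma fps_specialises_unique: "fps_specialises A B \<Longrightarrow> fps_specialises A B' \<Longrightarrow> B = B'"
  unfolding fps_specialises_def by (metis fps_ext specialises_unique)

lemma qh_neq_inverse: "qh - inverse qh \<noteq> 0"
  using qh_power_neq_inverse[of 0] by simp

text \<open>
  Cancelling \<open>s - 1\<close> from numerator and denominator leaves \<open>s (1 + s + \<dots> + s\<^bsup>m-1\<^esup>) / (s + 1)\<close>.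
\<close>

lemma specialises_q_number_nat:
  "specialises ah 1 ((qh ^ m - 1) / (qh - inverse qh)) (of_nat m / 2)"
proof -
  have "qh \<noteq> - 1"
  proof
    assume q: "qh = - 1"
    have "qh - inverse qh = 0" unfolding q by simp
    then show False using qh_neq_inverse by simp
  qed
  then have ne: "qh + 1 \<noteq> 0" by (simp add: eq_neg_iff_add_eq_0)
  have "(qh ^ m - 1) / (qh - inverse qh) = qh * (\<Sum>i<m. qh ^ i) / (qh + 1)"
  proof -
    have "(qh ^ m - 1) * (qh + 1) = (qh * (\<Sum>i<m. qh ^ i)) * (qh - inverse qh)"
      unfolding power_diff_1_eq by (simp add: algebra_simps)
    then show ?thesis using qh_neq_inverse ne by (simp add: frac_eq_eq)
  qed
  moreover have "specialises ah 1 (qh * (\<Sum>i<m. qh ^ i) / (qh + 1)) (1 * (\<Sum>i<m. 1 ^ i) / (1 + 1))"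
    by (intro specialises_divide specialises_mult specialises_sum specialises_add specialises_power
        specialises_qh specialises_1) simp
  ultimately show ?thesis by simp
qed

lemma specialises_q_number:
  "specialises ah 1 ((qh powi m - 1) / (qh - inverse qh)) (of_int m / 2)"
proof (cases m)
  case (nonneg n)
  then show ?thesis using specialises_q_number_nat[of n] by simp
next
  case (neg n)
  define k where "k = Suc n"
  have m: "m = - int k" using neg by (simp add: k_def)
  have "qh powi m - 1 = - (inverse (qh ^ k) * (qh ^ k - 1))"
    unfolding m power_int_minus power_int_of_nat by (simp add: right_diff_distrib)
  then have "(qh powi m - 1) / (qh - inverse qh) = - (inverse (qh ^ k) * ((qh ^ k - 1) / (qh - inverse qh)))"
    by simp
  moreover have "specialises ah 1 (- (inverse (qh ^ k) * ((qh ^ k - 1) / (qh - inverse qh)))) (- (inverse (1 ^ k) * (of_nat k / 2)))"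
    by (intro specialises_uminus specialises_mult specialises_inverse specialises_power specialises_qh
        specialises_q_number_nat) simp
  ultimately show ?thesis by (simp add: m)
qed

lemma specialises_q_quotient:
  assumes "d \<ge> 1"
  shows "specialises ah 1 ((qh - inverse qh) / (qh ^ d - inverse (qh ^ d))) (1 / of_nat d)"
proof -
  have "specialises ah 1 ((qh powi int d - 1) / (qh - inverse qh) - (qh powi (- int d) - 1) / (qh - inverse qh))
     (of_int (int d) / 2 - of_int (- int d) / 2)"
    by (intro specialises_diff specialises_q_number)
  moreover have "(qh powi int d - 1) / (qh - inverse qh) - (qh powi (- int d) - 1) / (qh - inverse qh) =
      (qh ^ d - inverse (qh ^ d)) / (qh - inverse qh)"
    by (simp add: power_int_minus diff_divide_distrib)
  ultimately have "specialises ah 1 ((qh ^ d - inverse (qh ^ d)) / (qh - inverse qh)) (of_nat d)"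
    by simp
  then have "specialises ah 1 (inverse ((qh ^ d - inverse (qh ^ d)) / (qh - inverse qh))) (inverse (of_nat d))"
    using assms by (intro specialises_inverse) simp_all
  then show ?thesis by (simp add: inverse_eq_divide)
qed

text \<open>
  The substitution \<open>x \<mapsto> s\<^sup>k x\<close>.
\<close>

definition q_dilate :: "int \<Rightarrow> ratfun fps \<Rightarrow> ratfun fps" where
  "q_dilate k F = F oo (fps_const (qh powi k) * fps_X)"

lemma q_dilate_nth: "q_dilate k F $ n = qh powi (k * int n) * F $ n"
  by (simp add: q_dilate_def fps_compose_linear power_int_mult)

lemma q_dilate_Exp:
  assumes "P $ 0 = 0"
  shows "q_dilate k (fps_Exp P) = fps_Exp P * fps_Exp (q_dilate k P - P)"
proof -
  have "q_dilate k (fps_Exp P) = fps_Exp (q_dilate k P)"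
    unfolding q_dilate_def fps_Exp_def by (rule fps_compose_assoc[symmetric]) (simp_all add: assms)
  also have "\<dots> = fps_Exp (P + (q_dilate k P - P))" by simp
  also have "\<dots> = fps_Exp P * fps_Exp (q_dilate k P - P)"
    by (rule fps_Exp_add) (simp_all add: assms q_dilate_nth)
  finally show ?thesis .
qed

lemma q_difference_equation:
  fixes \<tau> :: int
  defines "F \<equiv> Abs_fps (framed_homfly_unknot \<tau>)"
  shows "q_dilate 1 F - q_dilate (- 1) F =
    fps_X * (fps_const ((- 1) powi \<tau>) *
      (fps_const ah * q_dilate (2 * \<tau> + 1) F - fps_const (inverse ah) * q_dilate (2 * \<tau> - 1) F))"
proof (rule fps_ext)
  fix n
  show "(q_dilate 1 F - q_dilate (- 1) F) $ n =
    (fps_X * (fps_const ((- 1) powi \<tau>) *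
      (fps_const ah * q_dilate (2 * \<tau> + 1) F - fps_const (inverse ah) * q_dilate (2 * \<tau> - 1) F))) $ n"
  proof (cases n)
    case 0
    then show ?thesis by (simp add: q_dilate_nth)
  next
    case (Suc m)
    have plus: "qh powi ((2 * \<tau> + 1) * int m) = qh powi (2 * int m * \<tau>) * qh ^ m"
      by (simp add: algebra_simps power_int_add)
    have minus: "qh powi ((2 * \<tau> - 1) * int m) = qh powi (2 * int m * \<tau>) * inverse (qh ^ m)"
      by (simp add: algebra_simps power_int_diff divide_inverse)
    have "qh powi (1 * int n) - qh powi (- 1 * int n) = qh ^ Suc m - inverse (qh ^ Suc m)"
      unfolding Suc by (simp only: mult_1_left mult_minus_left power_int_minus power_int_of_nat)
    then have L: "(q_dilate 1 F - q_dilate (- 1) F) $ n = (qh ^ Suc m - inverse (qh ^ Suc m)) * F $ n"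
      by (simp only: fps_sub_nth q_dilate_nth flip: left_diff_distrib)
    have R: "(fps_X * (fps_const ((- 1) powi \<tau>) *
      (fps_const ah * q_dilate (2 * \<tau> + 1) F - fps_const (inverse ah) * q_dilate (2 * \<tau> - 1) F))) $ n =
      (- 1) powi \<tau> * (ah * (qh powi ((2 * \<tau> + 1) * int m) * F $ m) -
        inverse ah * (qh powi ((2 * \<tau> - 1) * int m) * F $ m))"
      by (simp add: Suc q_dilate_nth)
    show ?thesis
      using framed_homfly_unknot_Suc[of m \<tau>]
      unfolding laurent3_eval_unknot_lead laurent3_eval_unknot_tail L R plus minus
      by (simp add: F_def Suc algebra_simps del: power_Suc)
  qed
qed

text \<open>
  Both sides of the functional equation are divided by \<open>F = fps_Exp P\<close> before the limit is taken, since
  \<open>F\<close> itself has poles at \<open>s = 1\<close>, while the quotients of dilated series are regular. The coefficient of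
  \<open>P(s\<^sup>k x) - P(x)\<close> is \<open>(s\<^bsup>k n\<^esup> - 1) P\<^sub>n\<close>, a product of the regular functions \<open>(s\<^bsup>k n\<^esup> - 1) / (s - s\<^sup>-\<^sup>1)\<close> and
  \<open>(s - s\<^sup>-\<^sup>1) P\<^sub>n\<close>.
\<close>

lemma classical_limit_equation:
  assumes H: "Abs_fps (framed_homfly_unknot \<tau>) = fps_Exp P" and P0: "P $ 0 = 0"
    and G: "\<And>n. specialises ah 1 ((qh - inverse qh) * P $ n) (G n)"
  defines "g \<equiv> Abs_fps (\<lambda>n. of_nat n * G n)"
  shows "fps_Exp g - 1 = fps_X * (fps_const ((- 1) powi \<tau>) *
      (fps_const ah * fps_Exp_multiple g (\<tau> + 1) - fps_const (inverse ah) * fps_Exp_multiple g \<tau>))"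
proof -
  \<comment> \<open>Dilation by \<open>s\<close> is the square root of the dilation by \<open>q\<close>; \<open>exp h\<close> is the variable \<open>y\<close> of the dual
    A-polynomial and \<open>exp g = y\<^sup>2\<close>.\<close>
  define h where "h = fps_const (1 / 2) * g"
  have g0: "g $ 0 = 0" and h0: "h $ 0 = 0" by (simp_all add: g_def h_def)
  let ?Q = "\<lambda>k. fps_Exp (q_dilate k P - P)" and ?E = "fps_Exp_multiple h"
  have lim: "fps_specialises (?Q k) (?E k)" for k
    unfolding fps_Exp_multiple_def
  proof (rule fps_specialises_Exp, unfold fps_specialises_def, rule allI)
    fix n
    have "specialises ah 1 ((qh powi (k * int n) - 1) / (qh - inverse qh) * ((qh - inverse qh) * P $ n))
        (of_int (k * int n) / 2 * G n)"
      by (intro specialises_mult specialises_q_number G)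
    moreover have "x / (qh - inverse qh) * ((qh - inverse qh) * y) = x * y" for x y
      using qh_neq_inverse by simp
    then have "(qh powi (k * int n) - 1) / (qh - inverse qh) * ((qh - inverse qh) * P $ n) = (q_dilate k P - P) $ n"
      by (simp only: q_dilate_nth fps_sub_nth left_diff_distrib mult_1_left)
    ultimately have "specialises ah 1 ((q_dilate k P - P) $ n) (of_int (k * int n) / 2 * G n)"
      by (simp only:)
    then show "specialises ah 1 ((q_dilate k P - P) $ n) ((fps_const (of_int k) * h) $ n)"
      by (simp add: h_def g_def mult.assoc)
  qed
  let ?R = "\<lambda>E. fps_X * (fps_const ((- 1) powi \<tau>) *
      (fps_const ah * E (2 * \<tau> + 1) - fps_const (inverse ah) * E (2 * \<tau> - 1)))"
  have "fps_Exp P * (?Q 1 - ?Q (- 1)) = fps_Exp P * ?R ?Q"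
    using q_difference_equation[of \<tau>] unfolding H q_dilate_Exp[OF P0] by (simp add: algebra_simps)
  moreover have "fps_Exp P \<noteq> 0" by (metis fps_Exp_nth_0 fps_zero_nth zero_neq_one)
  ultimately have Q: "?Q 1 - ?Q (- 1) = ?R ?Q" by simp
  have "specialises ah 1 ((- 1) powi \<tau>) ((- 1) powi \<tau>)"
    using specialises_powi[OF specialises_uminus[OF specialises_1]] by simp
  moreover have "specialises ah 1 (inverse ah) (inverse ah)"
    by (intro specialises_inverse specialises_ah) simp
  ultimately have "fps_specialises (?R ?Q) (?R ?E)"
    by (intro fps_specialises_mult fps_specialises_diff fps_specialises_X fps_specialises_const lim specialises_ah)
  moreover have "fps_specialises (?Q 1 - ?Q (- 1)) (?E 1 - ?E (- 1))"
    by (intro fps_specialises_diff lim)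
  ultimately have "?E 1 - ?E (- 1) = ?R ?E"
    unfolding Q by (rule fps_specialises_unique[rotated])
  \<comment> \<open>Multiplying by \<open>y\<close> makes all exponents even.\<close>
  then have "(?E 1 - ?E (- 1)) * ?E 1 = ?R ?E * ?E 1" by (rule arg_cong)
  moreover have "(?E 1 - ?E (- 1)) * ?E 1 = ?E 2 - 1"
    by (simp add: left_diff_distrib flip: fps_Exp_multiple_add[OF h0])
  moreover have "?R ?E * ?E 1 = ?R (\<lambda>k. ?E k * ?E 1)"
    by (simp add: algebra_simps)
  moreover have "?E (2 * p) = fps_Exp_multiple g p" for p
    unfolding fps_Exp_multiple_def h_def by (simp add: mult.assoc[symmetric])
  moreover have "?E (2 * \<tau> + 1) * ?E 1 = ?E (2 * (\<tau> + 1))" "?E (2 * \<tau> - 1) * ?E 1 = ?E (2 * \<tau>)"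
    by (simp_all add: algebra_simps flip: fps_Exp_multiple_add[OF h0])
  moreover have "?E 2 = fps_Exp_multiple g 1" using \<open>\<And>p. ?E (2 * p) = fps_Exp_multiple g p\<close>[of 1] by simp
  ultimately show ?thesis by (simp only: fps_Exp_multiple_1)
qed

section \<open>The BPS invariants\<close>

text \<open>
  Laurent polynomials in \<open>a\<^sup>1\<^sup>/\<^sup>2\<close> alone, embedded into the field; the embedding is injective, which
  allows the comparison of coefficients.
\<close>

definition laurent_in_a :: "(int \<Rightarrow>\<^sub>0 rat) \<Rightarrow> ratfun" where
  "laurent_in_a p = (\<Sum>m\<in>Poly_Mapping.keys p. of_rat (Poly_Mapping.lookup p m) * ah powi m)"

lemma laurent_in_a_add: "laurent_in_a (p + p') = laurent_in_a p + laurent_in_a p'"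
  unfolding laurent_in_a_def by (rule setsum_keys_plus_distrib) (simp_all add: of_rat_add distrib_right)

lemma laurent_in_a_0 [simp]: "laurent_in_a 0 = 0"
  by (simp add: laurent_in_a_def)

lemma laurent_in_a_single: "laurent_in_a (Poly_Mapping.single m c) = of_rat c * ah powi m"
  by (simp add: laurent_in_a_def)

lemma laurent_in_a_sum: "laurent_in_a (sum p A) = (\<Sum>x\<in>A. laurent_in_a (p x))"
  by (induction A rule: infinite_finite_induct) (simp_all add: laurent_in_a_add)

lemma laurent_in_a_inj:
  assumes "laurent_in_a p = laurent_in_a p'"
  shows "p = p'"
proof -
  let ?d = "p - p'"
  have "laurent_in_a ?d = 0" using laurent_in_a_add[of ?d p'] assms by simp
  then have zero: "(\<Sum>(j, l)\<in>Poly_Mapping.keys ?d \<times> {0}. of_rat (Poly_Mapping.lookup ?d (fst (j, l))) * ah powi j * qh powi l) = 0"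
    by (simp add: laurent_in_a_def flip: sum.cartesian_product)
  have "Poly_Mapping.lookup ?d (fst (m, 0 :: int)) = 0" if "m \<in> Poly_Mapping.keys ?d" for m
    by (rule monomials_independent[OF _ zero]) (use that in auto)
  then have "Poly_Mapping.lookup ?d m = 0" for m
    by (cases "m \<in> Poly_Mapping.keys ?d") (simp_all add: in_keys_iff)
  then show ?thesis by (intro poly_mapping_eqI) (simp add: lookup_minus)
qed

lemma of_rat_gbinomial: "of_rat (x gchoose k) = (of_rat x gchoose k :: 'a::field_char_0)"
proof -
  have "of_rat (fact k) = (fact k :: 'a)" by (metis of_nat_fact of_rat_of_nat_eq)
  then show ?thesis by (simp add: gbinomial_prod_rev of_rat_divide of_rat_prod of_rat_diff)
qed

lemma subst_powers_ooguri_vafa: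
  assumes "d \<ge> 1"
  shows "subst_powers d (\<Sum>(i, j)\<in>S. of_int (N i j) * ah powi i * qh powi j / (qh - inverse qh)) =
    (\<Sum>(i, j)\<in>S. of_int (N i j) * (ah ^ d) powi i * (qh ^ d) powi j / (qh ^ d - inverse (qh ^ d)))"
proof (rule subst_powers_eqI, rule specialises_sum)
  fix x :: "int \<times> int"
  obtain i j where x: "x = (i, j)" by (cases x)
  have "qh ^ d - inverse (qh ^ d) \<noteq> 0" using qh_power_neq_inverse[of "d - 1"] assms by simp
  then show "specialises (ah ^ d) (qh ^ d)
      (case x of (i, j) \<Rightarrow> of_int (N i j) * ah powi i * qh powi j / (qh - inverse qh))
      (case x of (i, j) \<Rightarrow> of_int (N i j) * (ah ^ d) powi i * (qh ^ d) powi j / (qh ^ d - inverse (qh ^ d)))"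
    unfolding x prod.case
    by (intro specialises_divide specialises_mult specialises_of_int specialises_powi specialises_ah
        specialises_qh specialises_diff specialises_inverse) simp_all
qed

lemma specialises_ooguri_vafa:
  assumes d: "d \<ge> 1"
  shows "specialises ah 1
    ((qh - inverse qh) * subst_powers d (\<Sum>(i, j)\<in>S. of_int (N i j) * ah powi i * qh powi j / (qh - inverse qh)))
    (\<Sum>(i, j)\<in>S. of_int (N i j) * ah powi (int d * i) / of_nat d)"
proof -
  have "(qh - inverse qh) * subst_powers d (\<Sum>(i, j)\<in>S. of_int (N i j) * ah powi i * qh powi j / (qh - inverse qh)) =
      (\<Sum>(i, j)\<in>S. of_int (N i j) * (ah ^ d) powi i * (qh ^ d) powi j * ((qh - inverse qh) / (qh ^ d - inverse (qh ^ d))))"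
    unfolding subst_powers_ooguri_vafa[OF d] sum_distrib_left
    by (intro sum.cong refl) (simp add: case_prod_beta)
  moreover have "specialises ah 1 \<dots> (\<Sum>(i, j)\<in>S. of_int (N i j) * (ah ^ d) powi i * (1 ^ d) powi j * (1 / of_nat d))"
    unfolding case_prod_beta
    by (intro specialises_sum specialises_mult specialises_of_int specialises_powi specialises_power specialises_ah
        specialises_qh specialises_q_quotient d) simp_all
  moreover have "(ah ^ d) powi i = ah powi (int d * i)" for i
    by (simp add: power_int_mult)
  ultimately show ?thesis by simp
qed

lemma divisor_pairs:
  fixes n :: nat
  assumes "n \<ge> 1"
  shows "{(d, r). 1 \<le> d \<and> 1 \<le> r \<and> r * d = n} = (\<lambda>d. (d, n div d)) ` {d. d dvd n}"
proof -
  have "(d, r) \<in> (\<lambda>d. (d, n div d)) ` {d. d dvd n}" if "1 \<le> d" "r * d = n" for d r :: nat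
    using that by (auto simp: image_iff)
  moreover have "1 \<le> d \<and> 1 \<le> n div d \<and> n div d * d = n" if "d dvd n" for d
    using that assms by (auto simp: Suc_le_eq dvd_div_eq_0_iff intro!: Nat.gr0I)
  ultimately show ?thesis by (auto simp: Suc_le_eq)
qed

text \<open>
  The value of \<open>(s - s\<^sup>-\<^sup>1) P\<^sub>n\<close> at \<open>s = 1\<close>. Of the two factors \<open>1/d\<close>, one stands in the plethystic sum and
  the other is the value of \<open>(s - s\<^sup>-\<^sup>1) / (s\<^sup>d - s\<^sup>-\<^sup>d)\<close>.
\<close>

definition plethystic_limit :: "(nat \<Rightarrow> int \<Rightarrow> int \<Rightarrow> int) \<Rightarrow> nat \<Rightarrow> int \<Rightarrow>\<^sub>0 rat" where
  "plethystic_limit N n = (\<Sum>d | d dvd n. \<Sum>(i, j)\<in>{(i, j). N (n div d) i j \<noteq> 0}.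
     Poly_Mapping.single (int d * i) (of_int (N (n div d) i j) / of_nat d ^ 2))"

lemma specialises_plethystic_sum:
  assumes OV: "ooguri_vafa_form f N" and n: "n \<ge> 1"
  shows "specialises ah 1 ((qh - inverse qh) * plethystic_sum f $ n) (laurent_in_a (plethystic_limit N n))"
proof -
  have "(qh - inverse qh) * plethystic_sum f $ n =
      (\<Sum>d | d dvd n. inverse (of_nat d) * ((qh - inverse qh) * subst_powers d (f (n div d))))"
    unfolding plethystic_sum_def fps_nth_Abs_fps divisor_pairs[OF n]
    by (subst sum.reindex) (simp_all add: inj_on_def sum_distrib_left mult_ac)
  moreover have "specialises ah 1 \<dots> (\<Sum>d | d dvd n. inverse (of_nat d) *
      (\<Sum>(i, j)\<in>{(i, j). N (n div d) i j \<noteq> 0}. of_int (N (n div d) i j) * ah powi (int d * i) / of_nat d))"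
  proof (intro specialises_sum specialises_mult specialises_inverse specialises_of_nat)
    fix d assume "d \<in> {d. d dvd n}"
    then have d: "d \<ge> 1" "n div d \<ge> 1"
      using n by (auto simp: Suc_le_eq dvd_div_eq_0_iff intro!: Nat.gr0I)
    show "of_nat d \<noteq> (0 :: ratfun)" using d by simp
    have f: "f (n div d) = (\<Sum>(i, j)\<in>{(i, j). N (n div d) i j \<noteq> 0}.
        of_int (N (n div d) i j) * ah powi i * qh powi j / (qh - inverse qh))"
      using OV d unfolding ooguri_vafa_form_def by blast
    show "specialises ah 1 ((qh - inverse qh) * subst_powers d (f (n div d)))
      (\<Sum>(i, j)\<in>{(i, j). N (n div d) i j \<noteq> 0}. of_int (N (n div d) i j) * ah powi (int d * i) / of_nat d)"
      unfolding f by (rule specialises_ooguri_vafa[OF d(1)])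
  qed
  moreover have "laurent_in_a (plethystic_limit N n) = (\<Sum>d | d dvd n. inverse (of_nat d) *
      (\<Sum>(i, j)\<in>{(i, j). N (n div d) i j \<noteq> 0}. of_int (N (n div d) i j) * ah powi (int d * i) / of_nat d))"
    unfolding plethystic_limit_def laurent_in_a_sum sum_distrib_left case_prod_beta laurent_in_a_single
    by (intro sum.cong refl) (simp add: of_rat_mult of_rat_inverse power2_eq_square divide_inverse mult_ac)
  ultimately show ?thesis by simp
qed

text \<open>
  The terms with exponent \<open>m\<close> are those with \<open>d i = m\<close>, so \<open>d\<close> divides \<open>m\<close> and \<open>i = m/d\<close>; the remaining
  sum over \<open>j\<close> is the BPS invariant.
\<close>

lemma lookup_plethystic_limit:
  assumes OV: "ooguri_vafa_form f N" and n: "n \<ge> 1"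
  shows "of_nat n ^ 2 * Poly_Mapping.lookup (plethystic_limit N n) m =
    (\<Sum>d | d dvd n \<and> int d dvd m. of_nat (n div d) ^ 2 * of_int (BPS_b N (n div d) (m div int d)))"
proof -
  have "of_nat n ^ 2 * Poly_Mapping.lookup (plethystic_limit N n) m =
    (\<Sum>d | d dvd n. \<Sum>(i, j)\<in>{(i, j). N (n div d) i j \<noteq> 0}.
       if int d * i = m then of_nat (n div d) ^ 2 * of_int (N (n div d) i j) else 0)"
    unfolding plethystic_limit_def lookup_sum sum_distrib_left
  proof (intro sum.cong refl, clarify)
    fix d i j assume d: "d dvd n"
    then have pos: "d \<ge> 1" using n by (auto simp: Suc_le_eq intro!: Nat.gr0I)
    moreover have "of_nat (n div d) = (of_nat n / of_nat d :: rat)" using d pos by (auto elim!: dvdE)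
    ultimately show "of_nat n ^ 2 * Poly_Mapping.lookup (Poly_Mapping.single (int d * i) (of_int (N (n div d) i j) / of_nat d ^ 2)) m =
        (if int d * i = m then of_nat (n div d) ^ 2 * of_int (N (n div d) i j) else 0 :: rat)"
      by (simp add: lookup_single when_def power_divide)
  qed
  also have "\<dots> = (\<Sum>d | d dvd n. if int d dvd m then of_nat (n div d) ^ 2 * of_int (BPS_b N (n div d) (m div int d)) else 0)"
  proof (intro sum.cong refl)
    fix d assume "d \<in> {d. d dvd n}"
    then have d: "d \<ge> 1" "n div d \<ge> 1"
      using n by (auto simp: Suc_le_eq dvd_div_eq_0_iff intro!: Nat.gr0I)
    let ?S = "{(i, j). N (n div d) i j \<noteq> 0}"
    have fin: "finite ?S" using OV d unfolding ooguri_vafa_form_def by blast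
    show "(\<Sum>(i, j)\<in>?S. if int d * i = m then of_nat (n div d) ^ 2 * of_int (N (n div d) i j) else 0) =
        (if int d dvd m then of_nat (n div d) ^ 2 * of_int (BPS_b N (n div d) (m div int d)) else (0 :: rat))"
    proof (cases "int d dvd m")
      case False
      then show ?thesis by (auto intro!: sum.neutral)
    next
      case True
      define i0 where "i0 = m div int d"
      have i0: "int d * i = m \<longleftrightarrow> i = i0" for i using True d by (auto simp: i0_def)
      have "(\<Sum>(i, j)\<in>?S. if int d * i = m then of_nat (n div d) ^ 2 * of_int (N (n div d) i j) else 0) =
          (\<Sum>x\<in>?S. if fst x = i0 then of_nat (n div d) ^ 2 * of_int (N (n div d) (fst x) (snd x)) else (0 :: rat))"
        by (simp add: case_prod_beta i0)
      also have "\<dots> = (\<Sum>x\<in>{x \<in> ?S. fst x = i0}. of_nat (n div d) ^ 2 * of_int (N (n div d) (fst x) (snd x)))"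
        by (rule sum.inter_filter[OF fin, symmetric])
      also have "{x \<in> ?S. fst x = i0} = Pair i0 ` {j. N (n div d) i0 j \<noteq> 0}" by auto
      also have "(\<Sum>x\<in>Pair i0 ` {j. N (n div d) i0 j \<noteq> 0}. of_nat (n div d) ^ 2 * of_int (N (n div d) (fst x) (snd x))) =
          (of_nat (n div d) ^ 2 * of_int (BPS_b N (n div d) i0) :: rat)"
        by (simp add: sum.reindex inj_on_def BPS_b_def sum_distrib_left)
      finally show ?thesis using True by (simp add: i0_def)
    qed
  qed
  also have "\<dots> = (\<Sum>d\<in>{d \<in> {d. d dvd n}. int d dvd m}. of_nat (n div d) ^ 2 * of_int (BPS_b N (n div d) (m div int d)))"
    using n by (intro sum.inter_filter[symmetric]) simp
  finally show ?thesis by simp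
qed

text \<open>
  The summation index \<open>i\<close> of Lagrange inversion corresponds to \<open>m = 2 i - n\<close>, that is \<open>i = (n + m)/2\<close>.
\<close>

lemma lagrange_sum_eq_BPS_c:
  assumes n: "n \<ge> 1"
  shows "((- 1) powi \<tau>) ^ n * (\<Sum>i\<le>n. of_nat (n choose i) * ah ^ i * (- inverse ah) ^ (n - i) *
           (of_int (int n * \<tau> + int i - 1) gchoose (n - 1))) =
         laurent_in_a (\<Sum>i\<le>n. Poly_Mapping.single (2 * int i - int n) (BPS_c \<tau> n (2 * int i - int n)))"
  unfolding laurent_in_a_sum laurent_in_a_single sum_distrib_left
proof (intro sum.cong refl)
  fix i assume "i \<in> {..n}"
  then have i: "i \<le> n" by simp
  have "ah powi (2 * int i - int n) = ah powi (int i + - int (n - i))" using i by simp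
  also have "\<dots> = ah ^ i * inverse ah ^ (n - i)"
    unfolding power_int_add[OF disjI1[OF ah_nonzero]] by (simp add: power_int_minus power_inverse)
  finally have ah: "ah powi (2 * int i - int n) = ah ^ i * inverse ah ^ (n - i)" .
  have half: "(int n + (2 * int i - int n)) div 2 = int i" by simp
  have sign: "((- 1) powi \<tau>) ^ n * (- 1) ^ (n - i) = ((- 1) powi (int n * \<tau> + int n + int i) :: ratfun)"
  proof -
    have "(- 1 :: ratfun) powi (int n * \<tau> + int n + int i) = (- 1) powi (int n * \<tau> + (int (n - i) + 2 * int i))"
      using i by (simp add: add_ac)
    also have "\<dots> = (- 1) powi (int n * \<tau>) * (- 1) ^ (n - i)"
      by (simp add: power_int_add power_int_mult)
    finally show ?thesis by (simp add: power_int_mult mult.commute[of "int n"])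
  qed
  have c: "BPS_c \<tau> n (2 * int i - int n) = (- 1) powi (int n * \<tau> + int n + int i) * of_nat (n choose i) *
      (of_int (int n * \<tau> + int i - 1) gchoose (n - 1))"
    unfolding BPS_c_def half using i by auto
  have "of_rat (BPS_c \<tau> n (2 * int i - int n)) = ((- 1) powi (int n * \<tau> + int n + int i) * of_nat (n choose i) *
      (of_int (int n * \<tau> + int i - 1) gchoose (n - 1)) :: ratfun)"
  proof -
    have "of_rat ((- 1) powi k) = ((- 1) powi k :: ratfun)" for k
      by (auto simp: power_int_minus_left of_rat_minus)
    then show ?thesis unfolding c of_rat_mult of_rat_gbinomial by (simp add: of_rat_diff of_rat_add of_rat_mult)
  qed
  then have "of_rat (BPS_c \<tau> n (2 * int i - int n)) * ah powi (2 * int i - int n) =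
      ((- 1) powi \<tau>) ^ n * (- 1) ^ (n - i) * of_nat (n choose i) *
      (of_int (int n * \<tau> + int i - 1) gchoose (n - 1)) * (ah ^ i * inverse ah ^ (n - i))"
    by (simp only: ah sign)
  also have "\<dots> = ((- 1) powi \<tau>) ^ n * (of_nat (n choose i) * ah ^ i * ((- 1) ^ (n - i) * inverse ah ^ (n - i)) *
           (of_int (int n * \<tau> + int i - 1) gchoose (n - 1)))"
    by (simp only: mult_ac)
  also have "(- 1) ^ (n - i) * inverse ah ^ (n - i) = (- inverse ah) ^ (n - i)"
    by (simp flip: power_mult_distrib)
  finally show "((- 1) powi \<tau>) ^ n * (of_nat (n choose i) * ah ^ i * (- inverse ah) ^ (n - i) *
       (of_int (int n * \<tau> + int i - 1) gchoose (n - 1))) =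
     of_rat (BPS_c \<tau> n (2 * int i - int n)) * ah powi (2 * int i - int n)"
    by (rule sym)
qed

lemma lookup_BPS_c_sum:
  "Poly_Mapping.lookup (\<Sum>i\<le>n. Poly_Mapping.single (2 * int i - int n) (BPS_c \<tau> n (2 * int i - int n))) m =
     BPS_c \<tau> n m"
proof (cases "even (int n + m) \<and> \<bar>m\<bar> \<le> int n")
  case True
  define k where "k = nat ((int n + m) div 2)"
  have k: "k \<le> n" "m = 2 * int k - int n" using True by (auto simp: k_def)
  have "Poly_Mapping.lookup (\<Sum>i\<le>n. Poly_Mapping.single (2 * int i - int n) (BPS_c \<tau> n (2 * int i - int n))) m =
      (\<Sum>i\<le>n. if i = k then BPS_c \<tau> n m else 0)"
    unfolding lookup_sum by (intro sum.cong refl) (auto simp: lookup_single when_def k(2))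
  then show ?thesis using k(1) by simp
next
  case False
  have "2 * int i - int n \<noteq> m" if "i \<le> n" for i using that False by auto
  then have "Poly_Mapping.lookup (\<Sum>i\<le>n. Poly_Mapping.single (2 * int i - int n) (BPS_c \<tau> n (2 * int i - int n))) m = 0"
    unfolding lookup_sum by (intro sum.neutral) (auto simp: lookup_single when_def)
  moreover have "BPS_c \<tau> n m = 0" unfolding BPS_c_def by (simp only: False if_False)
  ultimately show ?thesis by (simp only:)
qed

text \<open>
  The two evaluations of \<open>n\<^sup>2 G\<^sub>n\<close> meet here: Lagrange inversion computes it as the sum over \<open>m\<close> of
  \<open>BPS_c \<tau> n m\<close> times the power of \<open>a\<^sup>1\<^sup>/\<^sup>2\<close> with exponent \<open>m\<close>.
\<close>

lemma plethystic_limit_unknot: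
  assumes BPS: "BPS_functions (framed_homfly_unknot \<tau>) f" and OV: "ooguri_vafa_form f N" and n: "n \<ge> 1"
  shows "of_nat n ^ 2 * Poly_Mapping.lookup (plethystic_limit N n) m = BPS_c \<tau> n m"
proof -
  define P where "P = plethystic_sum f"
  have P0: "P $ 0 = 0" by (auto simp: P_def plethystic_sum_def intro!: sum.neutral)
  define G where "G n = (if n = 0 then 0 else laurent_in_a (plethystic_limit N n))" for n
  have G: "specialises ah 1 ((qh - inverse qh) * P $ n) (G n)" for n
    using specialises_plethystic_sum[OF OV, of n] by (auto simp: G_def P_def P0[unfolded P_def] specialises_0)
  define g where "g = Abs_fps (\<lambda>n. of_nat n * G n)"
  have "Abs_fps (framed_homfly_unknot \<tau>) = fps_Exp P"
    using BPS by (simp add: BPS_functions_def fps_Exp_def P_def)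
  from classical_limit_equation[OF this P0 G]
  have eq: "fps_Exp g - 1 = fps_X * (fps_const ((- 1) powi \<tau>) *
      (fps_const ah * fps_Exp_multiple g (\<tau> + 1) - fps_const (inverse ah) * fps_Exp_multiple g \<tau>))"
    by (simp only: g_def)
  have ne: "ah \<noteq> inverse ah" using ah_qh_power_neq_inverse[of 0] by simp
  have "of_nat n * g $ n = ((- 1) powi \<tau>) ^ n * (\<Sum>i\<le>n. of_nat (n choose i) * ah ^ i * (- inverse ah) ^ (n - i) *
           (of_int (int n * \<tau> + int i - 1) gchoose (n - 1)))"
    by (rule lagrange_two_exponentials[OF _ _ ne eq n]) (simp_all add: g_def)
  also have "\<dots> = laurent_in_a (\<Sum>i\<le>n. Poly_Mapping.single (2 * int i - int n) (BPS_c \<tau> n (2 * int i - int n)))"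
    by (rule lagrange_sum_eq_BPS_c[OF n])
  \<comment> \<open>The factor \<open>n\<^sup>2\<close> is written as an \<open>n\<^sup>2\<close>-fold sum to stay inside the image of the embedding.\<close>
  also have "of_nat n * g $ n = laurent_in_a (\<Sum>k<n * n. plethystic_limit N n)"
    using n by (simp only: laurent_in_a_sum) (simp add: g_def G_def)
  finally have "(\<Sum>k<n * n. plethystic_limit N n) =
      (\<Sum>i\<le>n. Poly_Mapping.single (2 * int i - int n) (BPS_c \<tau> n (2 * int i - int n)))"
    by (rule laurent_in_a_inj)
  then have "Poly_Mapping.lookup (\<Sum>k<n * n. plethystic_limit N n) m = BPS_c \<tau> n m"
    by (simp only: lookup_BPS_c_sum)
  then show ?thesis by (simp add: lookup_sum power2_eq_square del: sum_constant add: sum_constant[where 'a = rat])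
qed

theorem BPS_invariants_unknot:
  assumes "BPS_functions (framed_homfly_unknot \<tau>) f" "ooguri_vafa_form f N" "r \<ge> 1"
  shows "(of_int (BPS_b N r m) :: rat) = 1 / of_nat r ^ 2 *
     (\<Sum>d\<in>{d::nat. d dvd r \<and> int d dvd m}. of_int (moebius d) * BPS_c \<tau> (r div d) (m div int d))"
proof -
  have "BPS_c \<tau> n m = (\<Sum>d | d dvd n \<and> int d dvd m.
      of_nat (n div d) ^ 2 * of_int (BPS_b N (n div d) (m div int d)))" if "n \<ge> 1" for n m
    using plethystic_limit_unknot[OF assms(1,2) that, of m] lookup_plethystic_limit[OF assms(2) that, of m] by simp
  from moebius_inversion_pairs[OF this assms(3), of m]
  have "of_nat r ^ 2 * of_int (BPS_b N r m) =
     (\<Sum>d\<in>{d::nat. d dvd r \<and> int d dvd m}. of_int (moebius d) * BPS_c \<tau> (r div d) (m div int d))" .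
  then show ?thesis using assms(3) by (simp add: field_simps)
qed

theorem proposition1p1:
  fixes \<tau> :: int
  shows "((\<exists>P. is_dual_A_polynomial (framed_homfly_unknot \<tau>) P) \<and>
          (\<forall>P. is_dual_A_polynomial (framed_homfly_unknot \<tau>) P \<longrightarrow>
                 eq_up_to_monomial P (unknot_dual_A \<tau>))) \<and>
         (\<forall>f N. BPS_functions (framed_homfly_unknot \<tau>) f \<longrightarrow> ooguri_vafa_form f N \<longrightarrow>
            (\<forall>(r::nat) (m::int). r \<ge> 1 \<longrightarrow>
               (of_int (BPS_b N r m) :: rat) =
                 1 / of_nat r ^ 2 *
                 (\<Sum>d\<in>{d::nat. d dvd r \<and> int d dvd m}.
                    of_int (moebius d) * BPS_c \<tau> (r div d) (m div int d))))"
  using dual_A_polynomial_unknot BPS_invariants_unknot by blast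

end
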